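(* Let $X$ be a complex Banach space, $(\mathcal{I},\|\cdot\|_{\mathcal{I}})$ an operator ideal in $X$, and let $\varphi\in\mathcal{OM}_-$ with $\varphi'(-0)\neq\infty$. For any operators $A,B\in\mathcal{NP}(X)$ such that $D(A)\subseteq D(B)$ and $A-B$ belongs to $\mathcal{I}$, the operator $\varphi(A)-\varphi(B)$ also belongs to $\mathcal{I}$ and satisfies the inequality $$\|\varphi(A)-\varphi(B)\|_{\mathcal{I}}\le M_AM_B\,\varphi'(-0)\,\|A-B\|_{\mathcal{I}}.$$
   Context: A closed densely defined operator $A$ on $X$ is nonpositive, $A\in\mathcal{NP}(X)$, if $(0,\infty)\subset\rho(A)$ and $M_A:=\sup_{t>0}\|tR(t,A)\|<\infty$, where $R(t,A)=(tI-A)^{-1}$. $\mathcal{OM}_-$ denotes the class of negative complete Bernstein functions, normalized to have no affine part, i.e. the functions $\varphi(z)=\int_{(0,\infty)}\frac{z}{t-z}\,d\mu(t)$, $z\in\mathbb{C}\setminus(0,\infty)$, where $\mu$ is a (unique) positive measure on $(0,\infty)$ with $\int_{(0,\infty)}\frac{d\mu(t)}{1+t}<\infty$. Put $\varphi'(-0)=\lim_{s\to0,\,s<0}\varphi'(s)\in[0,\infty]$. For $A\in\mathcal{NP}(X)$, $\varphi(A)$ is the closure of the operator $x\mapsto\int_{(0,\infty)}AR(t,A)x\,d\mu(t)$, $x\in D(A)$. If $D(A)\subseteq D(B)$, the differences $A-B$ and $\varphi(A)-\varphi(B)$ are considered on the dense subspace $D(A)$; when bounded there they are identified with their bounded extensions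 to $X$. An operator ideal $(\mathcal{I},\|\cdot\|_{\mathcal{I}})$ in $X$ is a two-sided ideal $\mathcal{I}$ of the algebra $\mathcal{L}(X)$ of bounded operators on $X$, complete with respect to the norm $\|\cdot\|_{\mathcal{I}}$, with $\|PSQ\|_{\mathcal{I}}\le\|P\|\|S\|_{\mathcal{I}}\|Q\|$ and $\|S\|\le\|S\|_{\mathcal{I}}$ for all $P,Q\in\mathcal{L}(X)$, $S\in\mathcal{I}$ (the case $\mathcal{I}=\mathcal{L}(X)$ is allowed). *)

theory Defs
  imports "HOL-Analysis.Analysis"
begin

section \<open>Complex Banach spaces and bounded operators\<close>

class complex_banach = banach +
  fixes scaleC :: "complex \<Rightarrow> 'a \<Rightarrow> 'a" (infixr \<open>*\<^sub>C\<close> 75)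
  assumes scaleC_add_right: "a *\<^sub>C (x + y) = a *\<^sub>C x + a *\<^sub>C y"
    and scaleC_add_left: "(a + b) *\<^sub>C x = a *\<^sub>C x + b *\<^sub>C x"
    and scaleC_scaleC: "a *\<^sub>C (b *\<^sub>C x) = (a * b) *\<^sub>C x"
    and scaleR_scaleC: "r *\<^sub>R x = complex_of_real r *\<^sub>C x"
    and norm_scaleC: "norm (a *\<^sub>C x) = cmod a * norm x"

instantiation complex :: complex_banach
begin

definition scaleC_complex :: "complex \<Rightarrow> complex \<Rightarrow> complex"
  where "scaleC_complex a x = a * x"

instance
  by standard (simp_all add: scaleC_complex_def algebra_simps norm_mult scaleR_conv_of_real)

end

text \<open>The algebra L(X): the library type of bounded operators is real-linear, hence the
  extra condition. The operator norm is the same over the real and the complex field.\<close>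

definition bounded_ops :: "('a::complex_banach \<Rightarrow>\<^sub>L 'a) set" where
  "bounded_ops = {T. \<forall>c x. blinfun_apply T (c *\<^sub>C x) = c *\<^sub>C blinfun_apply T x}"

definition blinfun_scaleC ::
    "complex \<Rightarrow> ('a::complex_banach \<Rightarrow>\<^sub>L 'a) \<Rightarrow> ('a \<Rightarrow>\<^sub>L 'a)" where
  "blinfun_scaleC c T = Blinfun (\<lambda>x. c *\<^sub>C blinfun_apply T x)"

lemma blinfun_scaleC_apply [simp]:
  "blinfun_apply (blinfun_scaleC c T) x = c *\<^sub>C blinfun_apply T x"
proof -
  have "bounded_linear (\<lambda>x. c *\<^sub>C blinfun_apply T x)"
  proof (rule bounded_linear_intro[where K = "norm T * cmod c"])
    fix x y and r :: real
    show "c *\<^sub>C blinfun_apply T (x + y) = c *\<^sub>C blinfun_apply T x + c *\<^sub>C blinfun_apply T y"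
      by (simp add: blinfun.add_right scaleC_add_right)
    show "c *\<^sub>C blinfun_apply T (r *\<^sub>R x) = r *\<^sub>R c *\<^sub>C blinfun_apply T x"
      by (simp only: blinfun.scaleR_right, simp add: scaleR_scaleC scaleC_scaleC mult.commute)
    have "cmod c * norm (blinfun_apply T x) \<le> cmod c * (norm T * norm x)"
      by (intro mult_left_mono norm_blinfun) simp
    then show "norm (c *\<^sub>C blinfun_apply T x) \<le> norm x * (norm T * cmod c)"
      by (simp add: norm_scaleC mult_ac)
  qed
  then show ?thesis
    by (simp add: blinfun_scaleC_def bounded_linear_Blinfun_apply)
qed


section \<open>Operator ideals\<close>

definition operator_ideal ::
    "('a::complex_banach \<Rightarrow>\<^sub>L 'a) set \<Rightarrow> (('a \<Rightarrow>\<^sub>L 'a) \<Rightarrow> real) \<Rightarrow> bool" where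
  "operator_ideal J N \<longleftrightarrow>
     \<comment> \<open>two-sided ideal of the algebra\<close>
     J \<subseteq> bounded_ops \<and> 0 \<in> J \<and>
     (\<forall>S\<in>J. \<forall>T\<in>J. S + T \<in> J) \<and>
     (\<forall>c. \<forall>S\<in>J. blinfun_scaleC c S \<in> J) \<and>
     (\<forall>P\<in>bounded_ops. \<forall>S\<in>J. P o\<^sub>L S \<in> J \<and> S o\<^sub>L P \<in> J) \<and>
     \<comment> \<open>complex norm on \<open>J\<close>\<close>
     (\<forall>S\<in>J. 0 \<le> N S \<and> (N S = 0 \<longleftrightarrow> S = 0)) \<and>
     (\<forall>S\<in>J. \<forall>T\<in>J. N (S + T) \<le> N S + N T) \<and>
     (\<forall>c. \<forall>S\<in>J. N (blinfun_scaleC c S) = cmod c * N S) \<and>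
     \<comment> \<open>completeness\<close>
     (\<forall>\<sigma> :: nat \<Rightarrow> 'a \<Rightarrow>\<^sub>L 'a.
        (\<forall>n. \<sigma> n \<in> J) \<and> (\<forall>e>0. \<exists>K. \<forall>m\<ge>K. \<forall>n\<ge>K. N (\<sigma> m - \<sigma> n) < e)
          \<longrightarrow> (\<exists>S\<in>J. (\<lambda>n. N (\<sigma> n - S)) \<longlonglongrightarrow> 0)) \<and>
     \<comment> \<open>compatibility with the operator norm\<close>
     (\<forall>P\<in>bounded_ops. \<forall>Q\<in>bounded_ops. \<forall>S\<in>J. N (P o\<^sub>L S o\<^sub>L Q) \<le> norm P * N S * norm Q) \<and>
     (\<forall>S\<in>J. norm S \<le> N S)"


section \<open>Unbounded operators\<close>

text \<open>An unbounded operator is represented by its graph; its domain is the \<^const>\<open>Domain\<close>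
  of the graph.\<close>

type_synonym 'a unbounded_op = "('a \<times> 'a) set"

definition op_apply :: "'a unbounded_op \<Rightarrow> 'a \<Rightarrow> 'a" where
  "op_apply A x = (THE y. (x, y) \<in> A)"

definition linear_op :: "('a::complex_banach) unbounded_op \<Rightarrow> bool" where
  "linear_op A \<longleftrightarrow> single_valued A \<and> (0, 0) \<in> A \<and>
     (\<forall>x y x' y'. (x, y) \<in> A \<and> (x', y') \<in> A \<longrightarrow> (x + x', y + y') \<in> A) \<and>
     (\<forall>c x y. (x, y) \<in> A \<longrightarrow> (c *\<^sub>C x, c *\<^sub>C y) \<in> A)"

definition is_resolvent_at ::
    "complex \<Rightarrow> ('a::complex_banach) unbounded_op \<Rightarrow> ('a \<Rightarrow>\<^sub>L 'a) \<Rightarrow> bool" where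
  "is_resolvent_at z A R \<longleftrightarrow> R \<in> bounded_ops \<and>
     (\<forall>x\<in>Domain A. blinfun_apply R (z *\<^sub>C x - op_apply A x) = x) \<and>
     (\<forall>y. blinfun_apply R y \<in> Domain A \<and>
          z *\<^sub>C blinfun_apply R y - op_apply A (blinfun_apply R y) = y)"

definition resolvent_set :: "('a::complex_banach) unbounded_op \<Rightarrow> complex set" where
  "resolvent_set A = {z. \<exists>R. is_resolvent_at z A R}"

definition resolvent :: "complex \<Rightarrow> ('a::complex_banach) unbounded_op \<Rightarrow> ('a \<Rightarrow>\<^sub>L 'a)" where
  "resolvent z A = (THE R. is_resolvent_at z A R)"

text \<open>The set of norms is bounded above for nonpositive operators, so that the supremum in
  \<open>nonpos_const\<close> (the constant \<open>M\<close> of the operator) is the genuine one.\<close>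

definition nonpos_ops :: "('a::complex_banach) unbounded_op set" where
  "nonpos_ops = {A. linear_op A \<and> closed A \<and> closure (Domain A) = UNIV \<and>
     (\<forall>t::real. t > 0 \<longrightarrow> complex_of_real t \<in> resolvent_set A) \<and>
     bdd_above ((\<lambda>t::real. norm (t *\<^sub>R resolvent (complex_of_real t) A)) ` {0<..})}"

definition nonpos_const :: "('a::complex_banach) unbounded_op \<Rightarrow> real" where
  "nonpos_const A = (SUP t\<in>{0<..}. norm (t *\<^sub>R resolvent (complex_of_real t) A))"

text \<open>\<open>difference_on D A B T\<close>: the operators \<open>A\<close> and \<open>B\<close> are both defined on \<open>D\<close>, and \<open>A - B\<close>,
  considered on \<open>D\<close>, is bounded with bounded extension \<open>T\<close>. If \<open>D\<close> is dense,
  \<open>T\<close> is unique.\<close>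

definition difference_on ::
    "'a set \<Rightarrow> ('a::complex_banach) unbounded_op \<Rightarrow> 'a unbounded_op \<Rightarrow> ('a \<Rightarrow>\<^sub>L 'a) \<Rightarrow> bool" where
  "difference_on D A B T \<longleftrightarrow> T \<in> bounded_ops \<and> D \<subseteq> Domain A \<and> D \<subseteq> Domain B \<and>
     (\<forall>x\<in>D. blinfun_apply T x = op_apply A x - op_apply B x)"


section \<open>Negative complete Bernstein functions\<close>

definition represents_OM :: "real measure \<Rightarrow> (complex \<Rightarrow> complex) \<Rightarrow> bool" where
  "represents_OM \<mu> \<phi> \<longleftrightarrow>
     sets \<mu> = sets (restrict_space borel {0<..}) \<and>
     (\<integral>\<^sup>+ t. ennreal (1 / (1 + t)) \<partial>\<mu>) < \<infinity> \<and>
     (\<forall>z. z \<notin> complex_of_real ` {0<..} \<longrightarrow>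
        \<phi> z = (LINT t|\<mu>. z / (complex_of_real t - z)))"

definition OM_minus :: "(complex \<Rightarrow> complex) set" where
  "OM_minus = {\<phi>. \<exists>\<mu>. represents_OM \<mu> \<phi>}"

text \<open>The representing measure is unique, so the choice operator makes no actual choice.\<close>

definition OM_measure :: "(complex \<Rightarrow> complex) \<Rightarrow> real measure" where
  "OM_measure \<phi> = (SOME \<mu>. represents_OM \<mu> \<phi>)"

text \<open>The one-sided limit of the derivative at \<open>0\<close>, with values in the extended reals; the
  derivative is real on the negative half-line.\<close>

definition deriv_minus_zero :: "(complex \<Rightarrow> complex) \<Rightarrow> ereal" where
  "deriv_minus_zero \<phi> = Lim (at_left 0) (\<lambda>s::real. ereal (Re (deriv \<phi> (complex_of_real s))))"


section \<open>Functional calculus\<close>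

text \<open>The Bochner integral. The library's \<^const>\<open>has_bochner_integral\<close> is restricted to
  second countable spaces; here, for arbitrary Banach spaces, Borel measurability of the integrand
  is replaced by strong measurability.\<close>

definition has_strong_integral ::
    "'b measure \<Rightarrow> ('b \<Rightarrow> 'a::banach) \<Rightarrow> 'a \<Rightarrow> bool" where
  "has_strong_integral M f y \<longleftrightarrow> (\<exists>s :: nat \<Rightarrow> 'b \<Rightarrow> 'a.
     (\<forall>i. Bochner_Integration.simple_bochner_integrable M (s i)) \<and>
     (AE t in M. (\<lambda>i. s i t) \<longlonglongrightarrow> f t) \<and>
     (\<lambda>i. \<integral>\<^sup>+ t. ennreal (norm (f t - s i t)) \<partial>M) \<longlonglongrightarrow> 0 \<and>
     (\<lambda>i. Bochner_Integration.simple_bochner_integral M (s i)) \<longlonglongrightarrow> y)"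

text \<open>The closure of an operator is the closure of its graph.\<close>

definition op_fun ::
    "(complex \<Rightarrow> complex) \<Rightarrow> ('a::complex_banach) unbounded_op \<Rightarrow> 'a unbounded_op" where
  "op_fun \<phi> A = closure {(x, y). x \<in> Domain A \<and>
     has_strong_integral (OM_measure \<phi>)
       (\<lambda>t. op_apply A (blinfun_apply (resolvent (complex_of_real t) A) x)) y}"

end

theory Submission
  imports Defs
begin

text \<open>Differentiating under the integral and monotone convergence give
  \<open>\<phi>'(-0) = \<integral> 1/t d\<mu>\<close>. When this is finite, \<open>\<parallel>R(t,A)\<parallel> \<le> M\<^sub>A/t\<close> makes \<open>W = \<integral> R(t,A) d\<mu>\<close> a norm
  convergent integral, and \<open>\<phi>(A) x = W A x\<close> on the domain of \<open>A\<close>. Moreover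
  \<open>A R(t,A) - B R(t,B) = t (R(t,A) - R(t,B)) = t R(t,B) (A - B) R(t,A)\<close>, whose ideal norm is at
  most \<open>M\<^sub>A M\<^sub>B \<parallel>A - B\<parallel> / t\<close>, so that \<open>\<phi>(A) - \<phi>(B)\<close> is the integral of this family in the Banach
  space of the ideal. The closure defining \<open>\<phi>(A)\<close> is single-valued because its graph lies in the closed
  relation \<open>R(1,A) y = W A R(1,A) x\<close> and \<open>R(1,A)\<close> is injective.\<close>

section \<open>Strong integrals\<close>

lemma borel_measurable_norm_diff_simple:
  assumes "Bochner_Integration.simple_bochner_integrable M s" "Bochner_Integration.simple_bochner_integrable M r"
  shows "(\<lambda>t. ennreal (norm (s t - r t))) \<in> borel_measurable M"
proof -
  have "simple_function M (\<lambda>t. ennreal (norm (s t - r t)))"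
    using assms simple_function_compose2[of M s r "\<lambda>x y. ennreal (norm (x - y))"]
    by (auto elim: Bochner_Integration.simple_bochner_integrable.cases)
  then show ?thesis
    by (rule borel_measurable_simple_function)
qed

text \<open>The values of \<open>f\<close> may fill a nonseparable set and \<open>f\<close> need not
  be Borel measurable, yet its distance to a simple function is almost everywhere a
  \<open>liminf\<close> of measurable functions. This matters because the nonnegative integral of a
  nonmeasurable function is only a lower integral, for which subadditivity can fail.\<close>

lemma norm_diff_AE_measurable:
  fixes f :: "'b \<Rightarrow> 'a::real_normed_vector"
  assumes s: "\<And>i. Bochner_Integration.simple_bochner_integrable M (s i)"
    and lim: "AE t in M. (\<lambda>i. s i t) \<longlonglongrightarrow> f t"
    and r: "Bochner_Integration.simple_bochner_integrable M r"
  obtains g where "g \<in> borel_measurable M" "AE t in M. ennreal (norm (f t - r t)) = g t"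
proof
  show "(\<lambda>t. liminf (\<lambda>i. ennreal (norm (s i t - r t)))) \<in> borel_measurable M"
    using borel_measurable_norm_diff_simple[OF s r] by measurable
  show "AE t in M. ennreal (norm (f t - r t)) = liminf (\<lambda>i. ennreal (norm (s i t - r t)))"
    using lim
  proof eventually_elim
    case (elim t)
    then have "(\<lambda>i. ennreal (norm (s i t - r t))) \<longlonglongrightarrow> ennreal (norm (f t - r t))"
      by (intro tendsto_intros)
    then show ?case
      by (intro lim_imp_Liminf[symmetric]) auto
  qed
qed

lemma has_strong_integral_cong:
  assumes "\<And>t. t \<in> space M \<Longrightarrow> f t = g t"
  shows "has_strong_integral M f y \<longleftrightarrow> has_strong_integral M g y"
  unfolding has_strong_integral_def using assms
  by (simp cong: AE_cong_simp nn_integral_cong_simp)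

lemma has_strong_integral_diff:
  assumes "has_strong_integral M f x" "has_strong_integral M g y"
  shows "has_strong_integral M (\<lambda>t. f t - g t) (x - y)"
proof -
  obtain s where s: "\<And>i. Bochner_Integration.simple_bochner_integrable M (s i)"
    "AE t in M. (\<lambda>i. s i t) \<longlonglongrightarrow> f t"
    "(\<lambda>i. \<integral>\<^sup>+ t. ennreal (norm (f t - s i t)) \<partial>M) \<longlonglongrightarrow> 0"
    "(\<lambda>i. Bochner_Integration.simple_bochner_integral M (s i)) \<longlonglongrightarrow> x"
    using assms(1) unfolding has_strong_integral_def by blast
  obtain r where r: "\<And>i. Bochner_Integration.simple_bochner_integrable M (r i)"
    "AE t in M. (\<lambda>i. r i t) \<longlonglongrightarrow> g t"
    "(\<lambda>i. \<integral>\<^sup>+ t. ennreal (norm (g t - r i t)) \<partial>M) \<longlonglongrightarrow> 0"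
    "(\<lambda>i. Bochner_Integration.simple_bochner_integral M (r i)) \<longlonglongrightarrow> y"
    using assms(2) unfolding has_strong_integral_def by blast
  have *: "(\<integral>\<^sup>+ t. ennreal (norm ((f t - g t) - (s i t - r i t))) \<partial>M)
      \<le> (\<integral>\<^sup>+ t. ennreal (norm (f t - s i t)) \<partial>M) + (\<integral>\<^sup>+ t. ennreal (norm (g t - r i t)) \<partial>M)" for i
  proof -
    \<comment> \<open>Passing to measurable functions \<open>u\<close> and \<open>v\<close> that
      agree almost everywhere with the two errors makes the integral of their sum additive.\<close>
    obtain u where u: "u \<in> borel_measurable M" "AE t in M. ennreal (norm (f t - s i t)) = u t"
      using norm_diff_AE_measurable[OF s(1,2) s(1)[of i]] by metis
    obtain v where v: "v \<in> borel_measurable M" "AE t in M. ennreal (norm (g t - r i t)) = v t"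
      using norm_diff_AE_measurable[OF r(1,2) r(1)[of i]] by metis
    have "(\<integral>\<^sup>+ t. ennreal (norm ((f t - g t) - (s i t - r i t))) \<partial>M) \<le> (\<integral>\<^sup>+ t. u t + v t \<partial>M)"
    proof (rule nn_integral_mono_AE)
      show "AE t in M. ennreal (norm ((f t - g t) - (s i t - r i t))) \<le> u t + v t"
        using u(2) v(2)
      proof eventually_elim
        case (elim t)
        have "norm ((f t - g t) - (s i t - r i t)) \<le> norm (f t - s i t) + norm (g t - r i t)"
          using norm_triangle_ineq4[of "f t - s i t" "g t - r i t"] by (simp add: algebra_simps)
        then have "ennreal (norm ((f t - g t) - (s i t - r i t)))
            \<le> ennreal (norm (f t - s i t)) + ennreal (norm (g t - r i t))"
          by (simp flip: ennreal_plus)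
        then show ?case using elim by simp
      qed
    qed
    also have "\<dots> = integral\<^sup>N M u + integral\<^sup>N M v"
      using u(1) v(1) by (rule nn_integral_add)
    finally show ?thesis
      using nn_integral_cong_AE[OF u(2)] nn_integral_cong_AE[OF v(2)] by simp
  qed
  have "(\<lambda>i. \<integral>\<^sup>+ t. ennreal (norm ((f t - g t) - (s i t - r i t))) \<partial>M) \<longlonglongrightarrow> 0"
    by (rule tendsto_sandwich[OF _ _ tendsto_const tendsto_add[OF s(3) r(3), simplified]])
       (use * in auto)
  moreover have "AE t in M. (\<lambda>i. s i t - r i t) \<longlonglongrightarrow> f t - g t"
    using s(2) r(2) by eventually_elim (rule tendsto_diff)
  moreover have "(\<lambda>i. Bochner_Integration.simple_bochner_integral M (\<lambda>t. s i t - r i t)) \<longlonglongrightarrow> x - y"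
    using tendsto_diff[OF s(4) r(4)] by (simp add: simple_bochner_integral_diff s(1) r(1))
  moreover have "Bochner_Integration.simple_bochner_integrable M (\<lambda>t. s i t - r i t)" for i
    using simple_bochner_integrable_compose2[of "(-)", OF _ s(1)[of i] r(1)[of i]] by simp
  ultimately show ?thesis
    unfolding has_strong_integral_def by (intro exI[of _ "\<lambda>i t. s i t - r i t"]) simp
qed

text \<open>The norm of a simple integral is at most the integral of the norm, which for the zero
  function is the approximation error itself. So the approximating integrals tend to
  \<open>0\<close> as well as to \<open>y\<close>.\<close>

lemma has_strong_integral_zero_unique:
  assumes "has_strong_integral M (\<lambda>t. 0) y"
  shows "y = 0"
proof -
  obtain s where s: "\<And>i. Bochner_Integration.simple_bochner_integrable M (s i)"
    "(\<lambda>i. \<integral>\<^sup>+ t. ennreal (norm (0 - s i t)) \<partial>M) \<longlonglongrightarrow> 0"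
    "(\<lambda>i. Bochner_Integration.simple_bochner_integral M (s i)) \<longlonglongrightarrow> y"
    using assms unfolding has_strong_integral_def by blast
  have *: "ennreal (norm (Bochner_Integration.simple_bochner_integral M (s i)))
      \<le> (\<integral>\<^sup>+ t. ennreal (norm (0 - s i t)) \<partial>M)" for i
  proof -
    have "ennreal (norm (Bochner_Integration.simple_bochner_integral M (s i)))
        \<le> ennreal (Bochner_Integration.simple_bochner_integral M (\<lambda>t. norm (s i t)))"
      by (intro ennreal_leI simple_bochner_integral_norm_bound s)
    also have "\<dots> = (\<integral>\<^sup>+ t. ennreal (norm (s i t)) \<partial>M)"
      by (intro simple_bochner_integral_eq_nn_integral)
         (use simple_bochner_integrable_compose2[of "\<lambda>x y. norm x", OF _ s(1)[of i] s(1)[of i]] in auto)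
    finally show ?thesis by simp
  qed
  have "(\<lambda>i. ennreal (norm (Bochner_Integration.simple_bochner_integral M (s i)))) \<longlonglongrightarrow> 0"
    by (rule tendsto_sandwich[OF _ _ tendsto_const s(2)]) (use * in auto)
  moreover have "(\<lambda>i. ennreal (norm (Bochner_Integration.simple_bochner_integral M (s i)))) \<longlonglongrightarrow> ennreal (norm y)"
    by (intro tendsto_intros s(3))
  ultimately have "ennreal (norm y) = 0"
    using LIMSEQ_unique by blast
  then show ?thesis by simp
qed

lemma has_strong_integral_unique:
  assumes "has_strong_integral M f x" "has_strong_integral M f y"
  shows "x = y"
  using has_strong_integral_diff[OF assms] has_strong_integral_zero_unique[of M "x - y"] by simp

lemma has_strong_integral_bounded_linear:
  assumes h: "bounded_linear h" and f: "has_strong_integral M f y"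
  shows "has_strong_integral M (\<lambda>t. h (f t)) (h y)"
proof -
  interpret bounded_linear h by (rule h)
  obtain s where s: "\<And>i. Bochner_Integration.simple_bochner_integrable M (s i)"
    "AE t in M. (\<lambda>i. s i t) \<longlonglongrightarrow> f t"
    "(\<lambda>i. \<integral>\<^sup>+ t. ennreal (norm (f t - s i t)) \<partial>M) \<longlonglongrightarrow> 0"
    "(\<lambda>i. Bochner_Integration.simple_bochner_integral M (s i)) \<longlonglongrightarrow> y"
    using f unfolding has_strong_integral_def by blast
  obtain K where K: "0 < K" "\<And>x. norm (h x) \<le> norm x * K"
    using pos_bounded by blast
  have *: "(\<integral>\<^sup>+ t. ennreal (norm (h (f t) - h (s i t))) \<partial>M)
      \<le> ennreal K * (\<integral>\<^sup>+ t. ennreal (norm (f t - s i t)) \<partial>M)" for i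
  proof -
    obtain u where u: "u \<in> borel_measurable M" "AE t in M. ennreal (norm (f t - s i t)) = u t"
      using norm_diff_AE_measurable[OF s(1,2) s(1)[of i]] by metis
    have "(\<integral>\<^sup>+ t. ennreal (norm (h (f t) - h (s i t))) \<partial>M) \<le> (\<integral>\<^sup>+ t. ennreal K * u t \<partial>M)"
    proof (rule nn_integral_mono_AE)
      show "AE t in M. ennreal (norm (h (f t) - h (s i t))) \<le> ennreal K * u t"
        using u(2)
      proof eventually_elim
        case (elim t)
        have "ennreal (norm (h (f t) - h (s i t))) \<le> ennreal (K * norm (f t - s i t))"
          using K(2)[of "f t - s i t"] by (intro ennreal_leI) (simp add: diff mult.commute)
        then show ?case
          using K(1) elim by (simp add: ennreal_mult)
      qed
    qed
    also have "\<dots> = ennreal K * integral\<^sup>N M u"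
      using u(1) by (rule nn_integral_cmult)
    finally show ?thesis
      using nn_integral_cong_AE[OF u(2)] by simp
  qed
  have "(\<lambda>i. ennreal K * (\<integral>\<^sup>+ t. ennreal (norm (f t - s i t)) \<partial>M)) \<longlonglongrightarrow> ennreal K * 0"
    by (rule ennreal_tendsto_cmult[OF _ s(3)]) simp
  then have lim: "(\<lambda>i. ennreal K * (\<integral>\<^sup>+ t. ennreal (norm (f t - s i t)) \<partial>M)) \<longlonglongrightarrow> 0"
    by simp
  have "(\<lambda>i. \<integral>\<^sup>+ t. ennreal (norm (h (f t) - h (s i t))) \<partial>M) \<longlonglongrightarrow> 0"
    by (rule tendsto_sandwich[OF _ _ tendsto_const lim]) (use * in auto)
  moreover have "AE t in M. (\<lambda>i. h (s i t)) \<longlonglongrightarrow> h (f t)"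
    using s(2) by eventually_elim (rule tendsto)
  moreover have "(\<lambda>i. Bochner_Integration.simple_bochner_integral M (\<lambda>t. h (s i t))) \<longlonglongrightarrow> h y"
    using tendsto[OF s(4)] by (simp add: simple_bochner_integral_linear linear_axioms s(1))
  moreover have "Bochner_Integration.simple_bochner_integrable M (\<lambda>t. h (s i t))" for i
    using simple_bochner_integrable_compose2[of "\<lambda>x y. h x", OF _ s(1)[of i] s(1)[of i]] zero by simp
  ultimately show ?thesis
    unfolding has_strong_integral_def by (intro exI[of _ "\<lambda>i t. h (s i t)"]) simp
qed

text \<open>Abstracts an ideal as a real subspace with its own complete norm dominating the ambient
  one. Two instances are used: \<open>J\<close> with \<open>N\<close>, in which the difference of
  the two functions is integrated, and the full operator space with the operator norm, in which the
  resolvents are integrated.\<close>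

locale banach_subspace =
  fixes J :: "'v::banach set" and N :: "'v \<Rightarrow> real"
  assumes zero_mem: "0 \<in> J"
    and add_mem: "x \<in> J \<Longrightarrow> y \<in> J \<Longrightarrow> x + y \<in> J"
    and scaleR_mem: "x \<in> J \<Longrightarrow> r *\<^sub>R x \<in> J"
    and N_triangle: "x \<in> J \<Longrightarrow> y \<in> J \<Longrightarrow> N (x + y) \<le> N x + N y"
    and N_scaleR: "x \<in> J \<Longrightarrow> N (r *\<^sub>R x) = \<bar>r\<bar> * N x"
    and complete: "(\<And>n::nat. \<sigma> n \<in> J) \<Longrightarrow> (\<And>e. e > 0 \<Longrightarrow> \<exists>K. \<forall>m\<ge>K. \<forall>n\<ge>K. N (\<sigma> m - \<sigma> n) < e)
          \<Longrightarrow> \<exists>x\<in>J. (\<lambda>n. N (\<sigma> n - x)) \<longlonglongrightarrow> 0"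
    and norm_le_N: "x \<in> J \<Longrightarrow> norm x \<le> N x"
begin

lemma N_zero [simp]: "N 0 = 0"
  using N_scaleR[OF zero_mem, of 0] by simp

lemma N_nonneg: "x \<in> J \<Longrightarrow> 0 \<le> N x"
  using norm_le_N norm_ge_zero order_trans by blast

lemma diff_mem: "x \<in> J \<Longrightarrow> y \<in> J \<Longrightarrow> x - y \<in> J"
  using add_mem[of x "(-1) *\<^sub>R y"] scaleR_mem[of y "-1"] by simp

lemma N_minus: "x \<in> J \<Longrightarrow> N (- x) = N x"
  using N_scaleR[of x "-1"] by simp

lemma N_diff_triangle: "x \<in> J \<Longrightarrow> y \<in> J \<Longrightarrow> N (x - y) \<le> N x + N y"
  using N_triangle[of x "- y"] N_minus[of y] scaleR_mem[of y "-1"] by simp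

section \<open>Integrals with values in the subspace, estimated in its own norm\<close>

lemma sum_mem_and_bound:
  assumes "finite I" "\<And>i. i \<in> I \<Longrightarrow> g i \<in> J"
  shows "sum g I \<in> J \<and> N (sum g I) \<le> (\<Sum>i\<in>I. N (g i))"
  using assms
proof (induction rule: finite_induct)
  case empty then show ?case by (simp add: zero_mem)
next
  case (insert i I)
  then have "sum g I \<in> J \<and> N (sum g I) \<le> (\<Sum>i\<in>I. N (g i))" "g i \<in> J" by auto
  moreover then have "N (g i + sum g I) \<le> N (g i) + N (sum g I)"
    by (intro N_triangle) auto
  ultimately show ?case
    using insert.hyps by (auto intro: add_mem)
qed

text \<open>A simple integral is a finite real combination of values of \<open>s\<close>. The
  triangle inequality for \<open>N\<close> applies termwise, and regrouping the weights by the
  values of \<open>s\<close> turns the bound into the scalar integral of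
  \<open>N (s t)\<close>.\<close>

lemma simple_integral_mem_and_bound:
  assumes s: "Bochner_Integration.simple_bochner_integrable M s" and J: "\<And>t. s t \<in> J"
  shows "Bochner_Integration.simple_bochner_integral M s \<in> J"
    and "ennreal (N (Bochner_Integration.simple_bochner_integral M s)) \<le> (\<integral>\<^sup>+ t. ennreal (N (s t)) \<partial>M)"
proof -
  have sf: "simple_function M s" using s by (auto elim: Bochner_Integration.simple_bochner_integrable.cases)
  then have fin: "finite (s ` space M)" by (simp add: simple_functionD)
  have int: "Bochner_Integration.simple_bochner_integrable M (\<lambda>t. N (s t))"
    using simple_bochner_integrable_compose2[of "\<lambda>x y. N x", OF _ s s] by simp
  have *: "Bochner_Integration.simple_bochner_integral M s \<in> J \<and> N (Bochner_Integration.simple_bochner_integral M s)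
      \<le> (\<Sum>y\<in>s ` space M. N (measure M {t \<in> space M. s t = y} *\<^sub>R y))"
    unfolding Bochner_Integration.simple_bochner_integral_def by (rule sum_mem_and_bound[OF fin]) (use J scaleR_mem in auto)
  then show "Bochner_Integration.simple_bochner_integral M s \<in> J" by simp
  have "(\<Sum>y\<in>s ` space M. N (measure M {t \<in> space M. s t = y} *\<^sub>R y))
      = (\<Sum>y\<in>s ` space M. measure M {t \<in> space M. s t = y} *\<^sub>R N y)"
    using J by (intro sum.cong) (auto simp: N_scaleR)
  also have "\<dots> = Bochner_Integration.simple_bochner_integral M (\<lambda>t. N (s t))"
    by (rule simple_bochner_integral_partition[symmetric, OF int sf]) auto
  finally have "ennreal (N (Bochner_Integration.simple_bochner_integral M s))
      \<le> ennreal (Bochner_Integration.simple_bochner_integral M (\<lambda>t. N (s t)))"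
    using * by (intro ennreal_leI) simp
  also have "\<dots> = (\<integral>\<^sup>+ t. ennreal (N (s t)) \<partial>M)"
    by (rule simple_bochner_integral_eq_nn_integral[OF int]) (use J N_nonneg in auto)
  finally show "ennreal (N (Bochner_Integration.simple_bochner_integral M s)) \<le> (\<integral>\<^sup>+ t. ennreal (N (s t)) \<partial>M)" .
qed

text \<open>The bound \<open>K / t\<close> provides domination, and the Lipschitz estimate stands in
  for strong measurability: it forces explicit step functions to converge to \<open>f\<close>
  pointwise in \<open>N\<close>. Their integrals are Cauchy in \<open>N\<close>, so completeness of
  \<open>J\<close> itself places the integral in \<open>J\<close>.\<close>

lemma strong_integral_exists:
  fixes f :: "real \<Rightarrow> 'v"
  assumes sets: "sets M = sets (restrict_space borel {0<..})"
    and c: "0 \<le> c" "(\<integral>\<^sup>+ t. ennreal (1 / t) \<partial>M) = ennreal c"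
    and mem: "\<And>t. 0 < t \<Longrightarrow> f t \<in> J"
    and bound: "\<And>t. 0 < t \<Longrightarrow> N (f t) \<le> K / t"
    and lip: "\<And>t u. 0 < t \<Longrightarrow> t \<le> u \<Longrightarrow> N (f u - f t) \<le> C * (u - t) / t\<^sup>2"
  shows "\<exists>y\<in>J. N y \<le> K * c \<and> has_strong_integral M f y"
proof -
  have space: "space M = {0<..}"
    using sets_eq_imp_space_eq[OF sets] by (simp add: space_restrict_space)
  have meas: "g \<in> borel_measurable M" if "g \<in> borel_measurable borel" for g :: "real \<Rightarrow> 'b::topological_space"
    using measurable_restrict_space1[OF that] by (subst measurable_cong_sets[OF sets refl])
  have K0: "0 \<le> K"
    using bound[of 1] N_nonneg[OF mem[of 1]] by simp
  have C0: "0 \<le> C"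
    using lip[of 1 2] N_nonneg[OF diff_mem[OF mem[of 2] mem[of 1]]] by simp
  have int_K: "(\<integral>\<^sup>+ t. ennreal (L / t) \<partial>M) = ennreal (L * c)" if "0 \<le> L" for L
  proof -
    have "(\<integral>\<^sup>+ t. ennreal (L / t) \<partial>M) = (\<integral>\<^sup>+ t. ennreal L * ennreal (1 / t) \<partial>M)"
      using that by (intro nn_integral_cong) (simp add: space flip: ennreal_mult)
    also have "\<dots> = ennreal L * (\<integral>\<^sup>+ t. ennreal (1 / t) \<partial>M)"
      by (intro nn_integral_cmult meas) measurable
    finally show ?thesis
      using that c by (simp add: ennreal_mult)
  qed
  \<comment> \<open>Sampling at the right end point of each cell keeps the bound \<open>K / t\<close> valid for the step functions.\<close>
  define g where "g n t = real_of_int \<lceil>Suc n * t\<rceil> / Suc n" for n :: nat and t :: real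
  have g_ge: "t \<le> g n t" and g_le: "g n t - t \<le> 1 / Suc n" for n t
  proof -
    have "t \<le> real_of_int \<lceil>p * t\<rceil> / p \<and> real_of_int \<lceil>p * t\<rceil> / p - t \<le> 1 / p" if "0 < p" for p :: real
    proof -
      have "p * t / p \<le> real_of_int \<lceil>p * t\<rceil> / p" "real_of_int \<lceil>p * t\<rceil> / p \<le> (p * t + 1) / p"
        using that by (intro divide_right_mono; linarith)+
      then show ?thesis using that by (simp add: add_divide_distrib)
    qed
    from this[of "real (Suc n)"] show "t \<le> g n t" "g n t - t \<le> 1 / Suc n"
      unfolding g_def by simp_all
  qed
  \<comment> \<open>The cutoff at \<open>Suc n\<close> leaves finitely many cells of width
    \<open>1 / Suc n\<close>; beyond it the step function is zero.\<close>
  define s where "s n t = (if 0 < t \<and> t \<le> Suc n then f (g n t) else 0)" for n :: nat and t :: real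
  have s_mem: "s n t \<in> J" for n t
    using g_ge[of t n] by (auto simp: s_def zero_mem intro!: mem)
  have N_s: "N (s n t) \<le> K / t" if "0 < t" for n t
  proof -
    have "N (s n t) \<le> K / g n t" if "t \<le> Suc n"
      using \<open>0 < t\<close> g_ge[of t n] that bound[of "g n t"] by (simp add: s_def)
    moreover have "K / g n t \<le> K / t"
      using K0 \<open>0 < t\<close> g_ge[of t n] by (intro divide_left_mono) auto
    ultimately show ?thesis
      using K0 that by (cases "t \<le> Suc n") (auto simp: s_def)
  qed
  have s_int: "Bochner_Integration.simple_bochner_integrable M (s n)" for n
  proof
    \<comment> \<open>\<open>k t\<close> is the number of the cell, with \<open>0\<close> reserved
      for the region outside the cutoff; the ceiling of a positive number is never \<open>0\<close>.
      Thus \<open>s n\<close> factors through a measurable map with finite range.\<close>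
    define k where "k t = (if 0 < t \<and> t \<le> Suc n then \<lceil>Suc n * t\<rceil> else 0)" for t :: real
    have k_bd: "k t \<in> {0..int (Suc n * Suc n)}" for t
    proof -
      have "real (Suc n) * t \<le> real (Suc n * Suc n)" if "t \<le> Suc n"
        using that by (subst of_nat_mult) (intro mult_left_mono, auto)
      moreover have "- 1 < real (Suc n) * t" if "0 < t"
        using mult_pos_pos[OF _ that, of "real (Suc n)"] by linarith
      ultimately show ?thesis
        by (auto simp: k_def ceiling_le_iff simp del: of_nat_Suc of_nat_mult)
    qed
    have "k \<in> measurable borel (count_space UNIV)"
      unfolding k_def by measurable
    then have "k \<in> measurable M (count_space UNIV)"
      using measurable_restrict_space1 by (subst measurable_cong_sets[OF sets refl]) blast
    moreover have "finite (k ` space M)"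
      using k_bd by (intro finite_subset[of "k ` space M" "{0..int (Suc n * Suc n)}"]) auto
    ultimately have "simple_function M k"
      unfolding simple_function_def by (auto intro!: measurable_sets[of k M])
    then have "simple_function M (\<lambda>t. (if k t = 0 then 0 else f (real_of_int (k t) / Suc n)))"
      by (rule simple_function_compose1)
    moreover have "(if k t = 0 then 0 else f (real_of_int (k t) / Suc n)) = s n t" for t
    proof (cases "0 < t \<and> t \<le> Suc n")
      case True
      then have "0 < real (Suc n) * t" by (intro mult_pos_pos) auto
      then have "\<lceil>real (Suc n) * t\<rceil> \<noteq> 0" by linarith
      then show ?thesis using True by (simp add: s_def k_def g_def del: of_nat_Suc)
    qed (auto simp: s_def k_def)
    ultimately show "simple_function M (s n)"
      by simp
    \<comment> \<open>A Markov estimate: the support lies in \<open>{0<..Suc n}\<close>, where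
      \<open>Suc n / t\<close> is at least \<open>1\<close>.\<close>
    have "emeasure M {t \<in> space M. s n t \<noteq> 0} \<le> (\<integral>\<^sup>+ t. ennreal (Suc n / t) \<partial>M)"
    proof -
      have "emeasure M {t \<in> space M. s n t \<noteq> 0} = (\<integral>\<^sup>+ t. indicator {t \<in> space M. s n t \<noteq> 0} t \<partial>M)"
        using simple_functionD(2)[OF \<open>simple_function M (s n)\<close>, of "- {0}"]
        by (intro nn_integral_indicator[symmetric]) (simp add: vimage_def Int_def conj_commute)
      also have "\<dots> \<le> (\<integral>\<^sup>+ t. ennreal (Suc n / t) \<partial>M)"
        by (intro nn_integral_mono) (auto simp: s_def indicator_def space split: if_splits)
      finally show ?thesis .
    qed
    also have "\<dots> < \<infinity>"
      using int_K[of "Suc n"] by simp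
    finally show "emeasure M {t \<in> space M. s n t \<noteq> 0} \<noteq> \<infinity>" by simp
  qed
  \<comment> \<open>The Lipschitz error vanishes as \<open>n\<close> grows, but
    \<open>1 / t\<^sup>2\<close> need not be integrable near \<open>0\<close>. Taking the minimum
    with the crude bound \<open>2 * K / t\<close> gives an integrable majorant for dominated
    convergence; beyond the cutoff the error is that of approximating \<open>f t\<close> by
    zero.\<close>
  define h where "h n t = (if t \<le> Suc n then min (C * (1 / Suc n) / t\<^sup>2) (2 * K / t) else K / t)" for n :: nat and t :: real
  have h_meas: "(\<lambda>t. ennreal (h n t)) \<in> borel_measurable M" for n
    unfolding h_def by (intro meas) measurable
  have s_diff: "N (s n t - f t) \<le> h n t" if "0 < t" for n t
  proof (cases "t \<le> Suc n")
    case True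
    have "N (s n t - f t) \<le> C * (g n t - t) / t\<^sup>2"
      using lip[of t "g n t"] g_ge[of t n] that True by (simp add: s_def)
    also have "\<dots> \<le> C * (1 / Suc n) / t\<^sup>2"
      using C0 g_le[of n t] by (intro divide_right_mono mult_left_mono) auto
    finally have "N (s n t - f t) \<le> C * (1 / Suc n) / t\<^sup>2" .
    moreover have "N (s n t - f t) \<le> N (s n t) + N (f t)"
      by (intro N_diff_triangle s_mem mem that)
    ultimately show ?thesis
      using N_s[OF that, of n] bound[OF that] True by (simp add: h_def)
  qed (use that bound[OF that] in \<open>simp add: s_def h_def N_minus mem\<close>)
  have h_lim: "(\<lambda>n. \<integral>\<^sup>+ t. ennreal (h n t) \<partial>M) \<longlonglongrightarrow> 0"
  proof -
    have "(\<lambda>n. \<integral>\<^sup>+ t. ennreal (h n t) \<partial>M) \<longlonglongrightarrow> (\<integral>\<^sup>+ t. 0 \<partial>M)"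
    proof (rule nn_integral_dominated_convergence[where w = "\<lambda>t. ennreal (2 * K / t)"])
      show "(\<lambda>t. ennreal (2 * K / t)) \<in> borel_measurable M"
        by (intro meas) measurable
      show "(\<integral>\<^sup>+ t. ennreal (2 * K / t) \<partial>M) < \<infinity>"
        using int_K[of "2 * K"] K0 by simp
      show "AE t in M. ennreal (h n t) \<le> ennreal (2 * K / t)" for n
        using K0 by (intro AE_I2 ennreal_leI) (auto simp: h_def space divide_right_mono)
      show "AE t in M. (\<lambda>n. ennreal (h n t)) \<longlonglongrightarrow> 0"
      proof (rule AE_I2)
        fix t assume "t \<in> space M"
        then have t: "0 < t" by (simp add: space)
        \<comment> \<open>From index \<open>m\<close> on, \<open>t\<close> lies below the cutoff and
          only the first branch of \<open>h\<close> remains.\<close>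
        obtain m where m: "t \<le> real m" using real_arch_simple by blast
        have "(\<lambda>n. C / t\<^sup>2 * inverse (real (Suc n))) \<longlonglongrightarrow> C / t\<^sup>2 * 0"
          by (intro tendsto_intros LIMSEQ_inverse_real_of_nat)
        then have "(\<lambda>n. C * (1 / Suc n) / t\<^sup>2) \<longlonglongrightarrow> 0"
          by (simp add: field_simps)
        then have "(\<lambda>n. h n t) \<longlonglongrightarrow> 0"
        proof (rule tendsto_sandwich[OF _ _ tendsto_const, rotated 2])
          show "\<forall>\<^sub>F n in sequentially. 0 \<le> h n t"
            using C0 K0 t by (intro always_eventually) (auto simp: h_def)
          show "\<forall>\<^sub>F n in sequentially. h n t \<le> C * (1 / Suc n) / t\<^sup>2"
            using eventually_ge_at_top[of m] by eventually_elim (use m in \<open>auto simp: h_def\<close>)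
        qed
        then show "(\<lambda>n. ennreal (h n t)) \<longlonglongrightarrow> 0"
          using tendsto_ennrealI by fastforce
      qed
    qed (use h_meas in auto)
    then show ?thesis by simp
  qed
  define I where "I n = Bochner_Integration.simple_bochner_integral M (s n)" for n
  have I_mem: "I n \<in> J" for n
    unfolding I_def by (rule simple_integral_mem_and_bound(1)[OF s_int s_mem])
  have I_bound: "N (I n) \<le> K * c" for n
  proof -
    have "ennreal (N (I n)) \<le> (\<integral>\<^sup>+ t. ennreal (N (s n t)) \<partial>M)"
      unfolding I_def by (rule simple_integral_mem_and_bound(2)[OF s_int s_mem])
    also have "\<dots> \<le> (\<integral>\<^sup>+ t. ennreal (K / t) \<partial>M)"
      using N_s by (intro nn_integral_mono ennreal_leI) (auto simp: space)
    finally show ?thesis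
      using int_K[OF K0] K0 c(1) by simp
  qed
  have I_diff: "ennreal (N (I m - I n)) \<le> (\<integral>\<^sup>+ t. ennreal (h m t) \<partial>M) + (\<integral>\<^sup>+ t. ennreal (h n t) \<partial>M)" for m n
  proof -
    have int: "Bochner_Integration.simple_bochner_integrable M (\<lambda>t. s m t - s n t)"
      using simple_bochner_integrable_compose2[of "(-)", OF _ s_int[of m] s_int[of n]] by simp
    have "ennreal (N (I m - I n)) = ennreal (N (Bochner_Integration.simple_bochner_integral M (\<lambda>t. s m t - s n t)))"
      by (simp add: I_def simple_bochner_integral_diff s_int)
    also have "\<dots> \<le> (\<integral>\<^sup>+ t. ennreal (N (s m t - s n t)) \<partial>M)"
      by (rule simple_integral_mem_and_bound(2)[OF int]) (intro diff_mem s_mem)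
    also have "\<dots> \<le> (\<integral>\<^sup>+ t. ennreal (h m t) + ennreal (h n t) \<partial>M)"
    proof (rule nn_integral_mono)
      fix t assume "t \<in> space M"
      then have t: "0 < t" by (simp add: space)
      have "N ((s m t - f t) - (s n t - f t)) \<le> N (s m t - f t) + N (s n t - f t)"
        by (intro N_diff_triangle diff_mem s_mem mem t)
      then have "N (s m t - s n t) \<le> h m t + h n t"
        using s_diff[OF t, of m] s_diff[OF t, of n] by simp
      moreover have "0 \<le> h m t" "0 \<le> h n t"
        using s_diff[OF t] N_nonneg[OF diff_mem[OF s_mem mem[OF t]]] order_trans by blast+
      ultimately show "ennreal (N (s m t - s n t)) \<le> ennreal (h m t) + ennreal (h n t)"
        by (simp add: ennreal_leI flip: ennreal_plus)
    qed
    also have "\<dots> = (\<integral>\<^sup>+ t. ennreal (h m t) \<partial>M) + (\<integral>\<^sup>+ t. ennreal (h n t) \<partial>M)"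
      by (intro nn_integral_add h_meas)
    finally show ?thesis .
  qed
  \<comment> \<open>The Cauchy property is checked in \<open>N\<close> rather than in the ambient
    norm, so that the limit is found inside \<open>J\<close>.\<close>
  have "\<exists>y\<in>J. (\<lambda>n. N (I n - y)) \<longlonglongrightarrow> 0"
  proof (rule complete)
    fix e :: real assume "0 < e"
    then have "\<forall>\<^sub>F n in sequentially. (\<integral>\<^sup>+ t. ennreal (h n t) \<partial>M) < ennreal (e / 2)"
      using h_lim by (intro order_tendstoD(2)) auto
    then obtain k where k: "\<And>n. n \<ge> k \<Longrightarrow> (\<integral>\<^sup>+ t. ennreal (h n t) \<partial>M) < ennreal (e / 2)"
      by (auto simp: eventually_sequentially)
    have "N (I m - I n) < e" if "m \<ge> k" "n \<ge> k" for m n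
    proof -
      have "ennreal (N (I m - I n)) < ennreal (e / 2) + ennreal (e / 2)"
        using I_diff[of m n] add_strict_mono[OF k[OF that(1)] k[OF that(2)]] by (rule le_less_trans)
      also have "\<dots> = ennreal e"
        using \<open>0 < e\<close> by (simp flip: ennreal_plus)
      finally show ?thesis
        using \<open>0 < e\<close> by (simp add: ennreal_less_iff N_nonneg diff_mem I_mem)
    qed
    then show "\<exists>k. \<forall>m\<ge>k. \<forall>n\<ge>k. N (I m - I n) < e" by blast
  qed (rule I_mem)
  then obtain y where y: "y \<in> J" "(\<lambda>n. N (I n - y)) \<longlonglongrightarrow> 0" by blast
  have "N y \<le> K * c"
  proof (rule LIMSEQ_le_const)
    show "(\<lambda>n. N (I n - y) + K * c) \<longlonglongrightarrow> K * c"
      using tendsto_add[OF y(2) tendsto_const[of "K * c"]] by simp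
    have "N y \<le> N (I n - y) + K * c" for n
      using N_diff_triangle[OF I_mem diff_mem[OF I_mem y(1)], of n n] I_bound[of n] by simp
    then show "\<exists>n0. \<forall>n\<ge>n0. N y \<le> N (I n - y) + K * c" by blast
  qed
  \<comment> \<open>Since \<open>N\<close> dominates the norm, the same step functions and the same
    limit serve in the ambient space.\<close>
  moreover have "has_strong_integral M f y"
    unfolding has_strong_integral_def
  proof (intro exI[of _ s] conjI allI)
    have norm_s: "norm (f t - s n t) \<le> h n t" if "0 < t" for n t
      using norm_le_N[OF diff_mem[OF s_mem mem[OF that]], of n t] s_diff[OF that, of n]
      by (simp add: norm_minus_commute)
    show "(\<lambda>n. \<integral>\<^sup>+ t. ennreal (norm (f t - s n t)) \<partial>M) \<longlonglongrightarrow> 0"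
      by (rule tendsto_sandwich[OF _ _ tendsto_const h_lim])
         (use norm_s in \<open>auto intro!: always_eventually nn_integral_mono ennreal_leI simp: space\<close>)
    show "AE t in M. (\<lambda>n. s n t) \<longlonglongrightarrow> f t"
    proof (rule AE_I2)
      fix t assume "t \<in> space M"
      then have t: "0 < t" by (simp add: space)
      obtain m where m: "t \<le> real m" using real_arch_simple by blast
      have "(\<lambda>n. C / t\<^sup>2 * inverse (real (Suc n))) \<longlonglongrightarrow> C / t\<^sup>2 * 0"
        by (intro tendsto_intros LIMSEQ_inverse_real_of_nat)
      then have "(\<lambda>n. C * (1 / Suc n) / t\<^sup>2) \<longlonglongrightarrow> 0"
        by (simp add: field_simps)
      then have "(\<lambda>n. s n t - f t) \<longlonglongrightarrow> 0"
      proof (rule Lim_null_comparison[rotated])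
        show "\<forall>\<^sub>F n in sequentially. norm (s n t - f t) \<le> C * (1 / Suc n) / t\<^sup>2"
          using eventually_ge_at_top[of m]
        proof eventually_elim
          case (elim n)
          then have "h n t \<le> C * (1 / Suc n) / t\<^sup>2"
            using m by (auto simp: h_def)
          then show ?case
            using norm_s[OF t, of n] by (simp add: norm_minus_commute)
        qed
      qed
      then show "(\<lambda>n. s n t) \<longlonglongrightarrow> f t"
        by (simp add: LIM_zero_iff)
    qed
    have "(\<lambda>n. I n - y) \<longlonglongrightarrow> 0"
      by (rule Lim_null_comparison[OF _ y(2)]) (auto intro!: always_eventually norm_le_N diff_mem I_mem y(1))
    then show "(\<lambda>n. Bochner_Integration.simple_bochner_integral M (s n)) \<longlonglongrightarrow> y"
      by (simp add: LIM_zero_iff I_def)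
  qed (rule s_int)
  ultimately show ?thesis
    using y(1) by blast
qed

end

section \<open>The derivative at the origin\<close>

lemma represents_OM_measurable:
  assumes "represents_OM \<mu> \<phi>" "g \<in> borel_measurable borel"
  shows "g \<in> borel_measurable \<mu>"
proof -
  have "sets \<mu> = sets (restrict_space borel {0<..})"
    using assms(1) by (simp add: represents_OM_def)
  then show ?thesis
    using measurable_restrict_space1[OF assms(2)] by (subst measurable_cong_sets[OF _ refl])
qed

lemma represents_OM_space:
  assumes "represents_OM \<mu> \<phi>"
  shows "space \<mu> = {0<..}"
  using sets_eq_imp_space_eq[of \<mu> "restrict_space borel {0<..}"] assms
  by (simp add: represents_OM_def space_restrict_space)

lemma represents_OM_integrable:
  fixes g :: "real \<Rightarrow> 'b::{banach, second_countable_topology}"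
  assumes \<mu>: "represents_OM \<mu> \<phi>" and g: "g \<in> borel_measurable borel"
    and bound: "\<And>t. 0 < t \<Longrightarrow> norm (g t) \<le> K / (1 + t)"
  shows "integrable \<mu> g"
proof -
  have "integrable \<mu> (\<lambda>t. 1 / (1 + t))"
    using \<mu> represents_OM_measurable[OF \<mu>, of "\<lambda>t. 1 / (1 + t)"]
    by (intro integrableI_nonneg) (auto simp: represents_OM_def represents_OM_space[OF \<mu>])
  then have "integrable \<mu> (\<lambda>t. K / (1 + t))"
    using integrable_mult_right[of K \<mu> "\<lambda>t. 1 / (1 + t)"] by simp
  moreover have "AE t in \<mu>. norm (g t) \<le> norm (K / (1 + t))"
  proof (rule AE_I2)
    fix t assume "t \<in> space \<mu>"
    then have "norm (g t) \<le> K / (1 + t)"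
      using bound by (simp add: represents_OM_space[OF \<mu>])
    then show "norm (g t) \<le> norm (K / (1 + t))"
      by (rule order_trans) (simp only: real_norm_def abs_ge_self)
  qed
  ultimately show ?thesis
    by (rule Bochner_Integration.integrable_bound[OF _ represents_OM_measurable[OF \<mu> g]])
qed

text \<open>The difference quotient minus the candidate derivative is \<open>z - s\<close> times an
  integral whose integrand is bounded, uniformly for \<open>z\<close> near \<open>s\<close>, by a
  multiple of \<open>1 / (1 + t)\<close>, the weight that \<open>represents_OM\<close> makes
  integrable.\<close>

lemma deriv_OM:
  assumes \<mu>: "represents_OM \<mu> \<phi>" and s: "s < 0"
  shows "integrable \<mu> (\<lambda>t. t / (t - s)\<^sup>2)"
    and "deriv \<phi> (complex_of_real s) = complex_of_real (LINT t|\<mu>. t / (t - s)\<^sup>2)"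
proof -
  \<comment> \<open>Chosen so that \<open>a * (1 + t) \<le> t - s\<close> for all positive
    \<open>t\<close>, which compares every denominator with a power of \<open>1 + t\<close>.\<close>
  define a where "a = min 1 (- s)"
  have a: "0 < a" "a \<le> 1" "a \<le> - s" using s by (auto simp: a_def)
  have ts: "a * (1 + t) \<le> t - s" if "0 < t" for t
  proof -
    have "a * t \<le> 1 * t" using a that by (intro mult_right_mono) auto
    then show ?thesis using a by (simp add: algebra_simps)
  qed
  have bd2: "norm (t / (t - s)\<^sup>2) \<le> (1 / a\<^sup>2) / (1 + t)" if "0 < t" for t
  proof -
    have "(a * (1 + t))\<^sup>2 \<le> (t - s)\<^sup>2"
      using ts[OF that] a that by (intro power_mono) auto
    then have "t / (t - s)\<^sup>2 \<le> (1 + t) / (a * (1 + t))\<^sup>2"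
      using a that s by (intro frac_le) auto
    also have "\<dots> = (1 / a\<^sup>2) / (1 + t)"
      using a that by (simp add: power2_eq_square)
    finally show ?thesis using that by simp
  qed
  show int: "integrable \<mu> (\<lambda>t. t / (t - s)\<^sup>2)"
    by (rule represents_OM_integrable[OF \<mu> _ bd2]) measurable
  define D where "D = (LINT t|\<mu>. complex_of_real (t / (t - s)\<^sup>2))"
  have int_D: "integrable \<mu> (\<lambda>t. complex_of_real (t / (t - s)\<^sup>2))"
    using int by (rule integrable_of_real)
  \<comment> \<open>Moving from \<open>s\<close> to \<open>z\<close> costs less than
    \<open>- s / 2\<close>, which is at most half of \<open>t - s\<close>. The bound also keeps the
    disc away from the positive half-line.\<close>
  have dist_z: "(t - s) / 2 \<le> cmod (complex_of_real t - z)" if "0 < t" "cmod (z - complex_of_real s) < - s / 2" for t z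
  proof -
    have "cmod (complex_of_real t - complex_of_real s) \<le> cmod (complex_of_real t - z) + cmod (z - complex_of_real s)"
      by (metis diff_add_cancel add_diff_eq norm_triangle_ineq)
    moreover have "cmod (complex_of_real t - complex_of_real s) = t - s"
      using that s by (metis abs_of_pos diff_gt_0_iff_gt norm_of_real of_real_diff order_less_trans)
    ultimately show ?thesis using that by simp
  qed
  have int_phi: "integrable \<mu> (\<lambda>t. z / (complex_of_real t - z))" if z: "cmod (z - complex_of_real s) < - s / 2" for z
  proof (rule represents_OM_integrable[OF \<mu>])
    fix t :: real assume t: "0 < t"
    have "cmod z / cmod (complex_of_real t - z) \<le> cmod z / (a * (1 + t) / 2)"
      using dist_z[OF t z] ts[OF t] a t by (intro divide_left_mono mult_pos_pos) auto
    then show "norm (z / (complex_of_real t - z)) \<le> (2 * cmod z / a) / (1 + t)"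
      by (simp add: norm_divide mult.commute)
  qed measurable
  have phi: "\<phi> z = (LINT t|\<mu>. z / (complex_of_real t - z))" if z: "cmod (z - complex_of_real s) < - s / 2" for z
  proof -
    have "z \<notin> complex_of_real ` {0<..}"
      using dist_z[OF _ z] s by force
    then show ?thesis using \<mu> by (simp add: represents_OM_def)
  qed
  \<comment> \<open>In \<open>2 / a^3\<close>, two factors \<open>1 / a\<close> come from
    \<open>(t - s)\<^sup>2\<close>; the third one and the \<open>2\<close> come from the bound
    \<open>dist_z\<close> on \<open>t - z\<close>.\<close>
  define L where "L = (LINT t|\<mu>. (2 / a^3) / (1 + t))"
  have est: "cmod ((\<phi> z - \<phi> (complex_of_real s)) / (z - complex_of_real s) - D) \<le> cmod (z - complex_of_real s) * L"
    if z: "cmod (z - complex_of_real s) < - s / 2" "z \<noteq> complex_of_real s" for z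
  proof -
    define r where "r t = 1 / (complex_of_real ((t - s)\<^sup>2) * (complex_of_real t - z)) * complex_of_real t" for t
    have s0: "cmod (complex_of_real s - complex_of_real s) < - s / 2" using s by simp
    have r_eq: "(z / (complex_of_real t - z) - complex_of_real s / (complex_of_real t - complex_of_real s)) / (z - complex_of_real s)
        - complex_of_real (t / (t - s)\<^sup>2) = (z - complex_of_real s) * r t" if "t \<in> space \<mu>" for t
    proof -
      have t: "0 < t" using that represents_OM_space[OF \<mu>] by simp
      have nz: "complex_of_real t - z \<noteq> 0" "complex_of_real t - complex_of_real s \<noteq> 0" "z - complex_of_real s \<noteq> 0"
        using dist_z[OF t z(1)] t s z(2) by (auto simp flip: of_real_diff)
      \<comment> \<open>In these variables \<open>z - s\<close> is \<open>q - p\<close>, and the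
        claim reduces to
        \<open>t / (p * q) - t / q\<^sup>2 = (q - p) * t / (q\<^sup>2 * p)\<close>.\<close>
      define p q where "p = complex_of_real t - z" and "q = complex_of_real t - complex_of_real s"
      have pq: "z = complex_of_real t - p" "complex_of_real s = complex_of_real t - q" "z - complex_of_real s = q - p"
        "p \<noteq> 0" "q \<noteq> 0" "q \<noteq> p" "complex_of_real ((t - s)\<^sup>2) = q\<^sup>2" "complex_of_real (t / (t - s)\<^sup>2) = complex_of_real t / q\<^sup>2"
        using nz by (auto simp: p_def q_def)
      have "(complex_of_real t - p) / p - (complex_of_real t - q) / q = complex_of_real t * (q - p) / (p * q)"
        using pq(4,5) by (simp add: field_simps)
      then have "((complex_of_real t - p) / p - (complex_of_real t - q) / q) / (q - p) - complex_of_real t / q\<^sup>2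
          = complex_of_real t / (p * q) - complex_of_real t / q\<^sup>2"
        using pq(6) by simp
      also have "\<dots> = (q - p) * (1 / (q\<^sup>2 * p) * complex_of_real t)"
        using pq(4,5) by (simp add: field_simps power2_eq_square)
      finally have "((complex_of_real t - p) / p - (complex_of_real t - q) / q) / (q - p) - complex_of_real t / q\<^sup>2
          = (q - p) * (1 / (q\<^sup>2 * p) * complex_of_real t)" .
      then show ?thesis
        unfolding r_def pq(3,7,8) p_def[symmetric] q_def[symmetric] unfolding pq(1,2) by simp
    qed
    have r_bd: "norm (r t) \<le> (2 / a^3) / (1 + t)" if "0 < t" for t
    proof -
      have "cmod (r t) = t / ((t - s)\<^sup>2 * cmod (complex_of_real t - z))"
        using that by (simp add: r_def norm_mult norm_divide norm_power flip: of_real_diff)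
      also have "\<dots> \<le> (1 + t)\<^sup>2 / ((a * (1 + t))\<^sup>2 * (a * (1 + t) / 2))"
      proof (rule frac_le)
        show "t \<le> (1 + t)\<^sup>2" using that by (simp add: power2_eq_square algebra_simps)
        show "(a * (1 + t))\<^sup>2 * (a * (1 + t) / 2) \<le> (t - s)\<^sup>2 * cmod (complex_of_real t - z)"
          using ts[OF that] dist_z[OF that z(1)] a that by (intro mult_mono power_mono) auto
      qed (use a that in auto)
      also have "\<dots> = (2 / a^3) / (1 + t)"
        using a that by (simp add: divide_simps power2_eq_square power3_eq_cube)
      finally show ?thesis .
    qed
    have r_meas: "r \<in> borel_measurable borel" unfolding r_def by measurable
    have r_int: "integrable \<mu> r" by (rule represents_OM_integrable[OF \<mu> r_meas r_bd])
    have "(\<phi> z - \<phi> (complex_of_real s)) / (z - complex_of_real s) - D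
      = (LINT t|\<mu>. (z / (complex_of_real t - z) - complex_of_real s / (complex_of_real t - complex_of_real s)) / (z - complex_of_real s)
        - complex_of_real (t / (t - s)\<^sup>2))"
    proof -
      note int_diff = Bochner_Integration.integrable_diff[OF int_phi[OF z(1)] int_phi[OF s0]]
      show ?thesis
        unfolding phi[OF z(1)] phi[OF s0] D_def
        by (simp only: Bochner_Integration.integral_diff[OF integrable_divide[OF int_diff] int_D]
              integral_divide_zero Bochner_Integration.integral_diff[OF int_phi[OF z(1)] int_phi[OF s0]])
    qed
    also have "\<dots> = (LINT t|\<mu>. (z - complex_of_real s) * r t)"
      by (intro Bochner_Integration.integral_cong refl r_eq)
    also have "\<dots> = (z - complex_of_real s) * (LINT t|\<mu>. r t)"
      by (rule integral_mult_right_zero)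
    finally have "cmod ((\<phi> z - \<phi> (complex_of_real s)) / (z - complex_of_real s) - D)
        = cmod (z - complex_of_real s) * cmod (LINT t|\<mu>. r t)"
      by (simp add: norm_mult)
    moreover have "cmod (LINT t|\<mu>. r t) \<le> L"
      unfolding L_def
    proof (rule Bochner_Integration.integral_norm_bound_integral[OF r_int])
      show "integrable \<mu> (\<lambda>t. (2 / a^3) / (1 + t))"
        using a by (intro represents_OM_integrable[OF \<mu>, of _ "2 / a^3"]) auto
    qed (use r_bd in \<open>simp add: represents_OM_space[OF \<mu>]\<close>)
    ultimately show ?thesis by (simp add: mult_left_mono)
  qed
  have "((\<lambda>z. (\<phi> z - \<phi> (complex_of_real s)) / (z - complex_of_real s) - D) \<longlongrightarrow> 0) (at (complex_of_real s))"
  proof (rule Lim_null_comparison)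
    have "\<forall>\<^sub>F z in at (complex_of_real s). dist z (complex_of_real s) < - s / 2 \<and> z \<noteq> complex_of_real s"
      using s by (auto simp: eventually_at intro!: exI[of _ "- s / 2"])
    then show "\<forall>\<^sub>F z in at (complex_of_real s). norm ((\<phi> z - \<phi> (complex_of_real s)) / (z - complex_of_real s) - D)
        \<le> cmod (z - complex_of_real s) * L"
      by eventually_elim (use est in \<open>auto simp: dist_norm\<close>)
    have "((\<lambda>z. cmod (z - complex_of_real s) * L) \<longlongrightarrow> cmod (complex_of_real s - complex_of_real s) * L) (at (complex_of_real s))"
      by (intro tendsto_intros)
    then show "((\<lambda>z. cmod (z - complex_of_real s) * L) \<longlongrightarrow> 0) (at (complex_of_real s))" by simp
  qed
  then have "(\<phi> has_field_derivative D) (at (complex_of_real s))"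
    by (simp add: has_field_derivative_iff LIM_zero_iff)
  then have "deriv \<phi> (complex_of_real s) = D" by (rule DERIV_imp_deriv)
  then show "deriv \<phi> (complex_of_real s) = complex_of_real (LINT t|\<mu>. t / (t - s)\<^sup>2)"
    by (simp add: D_def del: of_real_divide of_real_power)
qed

text \<open>As \<open>s\<close> increases to \<open>0\<close>, the integrands
  \<open>t / (t - s)\<^sup>2\<close> increase to \<open>1 / t\<close>, so monotone convergence
  applies; extended nonnegative values cover an infinite limit as well.\<close>

lemma deriv_minus_zero_eq:
  assumes \<mu>: "represents_OM \<mu> \<phi>"
  shows "deriv_minus_zero \<phi> = enn2ereal (\<integral>\<^sup>+ t. ennreal (1 / t) \<partial>\<mu>)"
proof -
  define g where "g s t = ennreal (t / (t - s)\<^sup>2)" for s t :: real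
  have eq: "ereal (Re (deriv \<phi> (complex_of_real s))) = enn2ereal (integral\<^sup>N \<mu> (g s))" if "s < 0" for s
  proof -
    have nn: "AE t in \<mu>. 0 \<le> t / (t - s)\<^sup>2"
      by (rule AE_I2) (simp add: represents_OM_space[OF \<mu>])
    have "integral\<^sup>N \<mu> (g s) = ennreal (LINT t|\<mu>. t / (t - s)\<^sup>2)"
      unfolding g_def by (rule nn_integral_eq_integral[OF deriv_OM(1)[OF \<mu> that] nn])
    then show ?thesis
      using deriv_OM(2)[OF \<mu> that] integral_nonneg_AE[OF nn] by simp
  qed
  have "((\<lambda>s. ereal (Re (deriv \<phi> (complex_of_real s)))) \<longlongrightarrow> enn2ereal (\<integral>\<^sup>+ t. ennreal (1 / t) \<partial>\<mu>)) (at_left (0::real))"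
  \<comment> \<open>A left limit may be tested on increasing sequences, which is the form monotone
    convergence asks for.\<close>
  proof (rule tendsto_at_left_sequentially)
    show "(-1::real) < 0" by simp
    fix S :: "nat \<Rightarrow> real"
    assume S: "\<And>n. S n < 0" "incseq S" "S \<longlonglongrightarrow> 0"
    have mono: "g (S m) t \<le> g (S n) t" if "m \<le> n" "0 < t" for m n t
    proof -
      have "(t - S n)\<^sup>2 \<le> (t - S m)\<^sup>2"
        using S(1)[of n] that incseqD[OF S(2) that(1)] by (intro power_mono) auto
      then show ?thesis
        unfolding g_def using that S(1)[of n] by (intro ennreal_leI divide_left_mono mult_pos_pos) auto
    qed
    \<comment> \<open>Monotonicity in \<open>s\<close> is available for positive \<open>t\<close>
      only. The indicator extends it to the whole line and leaves the integrals unchanged, as \<mu>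
      lives on \<open>{0<..}\<close>.\<close>
    have "(\<lambda>n. \<integral>\<^sup>+ t. g (S n) t * indicator {0<..} t \<partial>\<mu>)
        \<longlonglongrightarrow> (\<integral>\<^sup>+ t. ennreal (1 / t) * indicator {0<..} t \<partial>\<mu>)"
    proof (rule nn_integral_LIMSEQ)
      show "incseq (\<lambda>n t. g (S n) t * indicator {0<..} t)"
        using mono by (auto simp: incseq_def le_fun_def indicator_def)
      show "(\<lambda>t. g (S n) t * indicator {0<..} t) \<in> borel_measurable \<mu>" for n
        unfolding g_def by (intro represents_OM_measurable[OF \<mu>]) measurable
      show "(\<lambda>n. g (S n) t * indicator {0<..} t) \<longlonglongrightarrow> ennreal (1 / t) * indicator {0<..} t" for t :: real
      proof (cases "0 < t")
        case True
        then have "(\<lambda>n. t / (t - S n)\<^sup>2) \<longlonglongrightarrow> t / (t - 0)\<^sup>2"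
          by (intro tendsto_intros S(3)) auto
        then have "(\<lambda>n. t / (t - S n)\<^sup>2) \<longlonglongrightarrow> 1 / t"
          using True by (simp add: power2_eq_square)
        then show ?thesis
          using True by (simp add: g_def)
      qed simp
    qed
    moreover have "(\<integral>\<^sup>+ t. h t * indicator {0<..} t \<partial>\<mu>) = integral\<^sup>N \<mu> h" for h
      by (intro nn_integral_cong) (simp add: represents_OM_space[OF \<mu>])
    ultimately have "(\<lambda>n. integral\<^sup>N \<mu> (g (S n))) \<longlonglongrightarrow> (\<integral>\<^sup>+ t. ennreal (1 / t) \<partial>\<mu>)"
      by simp
    then show "(\<lambda>n. ereal (Re (deriv \<phi> (complex_of_real (S n))))) \<longlonglongrightarrow> enn2ereal (\<integral>\<^sup>+ t. ennreal (1 / t) \<partial>\<mu>)"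
      using eq[OF S(1)] by (simp add: tendsto_enn2erealI)
  qed
  then show ?thesis
    unfolding deriv_minus_zero_def by (intro tendsto_Lim) auto
qed

section \<open>Resolvents and the functional calculus\<close>

lemma scaleC_of_real: "complex_of_real r *\<^sub>C x = r *\<^sub>R x"
  by (simp add: scaleR_scaleC)

lemma scaleC_diff_right: "c *\<^sub>C (x - y) = c *\<^sub>C x - c *\<^sub>C (y :: 'a::complex_banach)"
  using scaleC_add_right[of c "x - y" y] by (simp add: algebra_simps)

lemma scaleC_scaleR_commute: "c *\<^sub>C r *\<^sub>R x = r *\<^sub>R c *\<^sub>C (x :: 'a::complex_banach)"
  by (simp add: scaleR_scaleC scaleC_scaleC mult.commute)

lemma bounded_ops_diff: "P \<in> bounded_ops \<Longrightarrow> Q \<in> bounded_ops \<Longrightarrow> P - Q \<in> bounded_ops"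
  by (simp add: bounded_ops_def blinfun.diff_left scaleC_diff_right)

lemma bounded_ops_scaleR: "P \<in> bounded_ops \<Longrightarrow> r *\<^sub>R P \<in> bounded_ops"
  by (simp add: bounded_ops_def blinfun.scaleR_left scaleC_scaleR_commute)

lemma blinfun_scaleC_of_real: "blinfun_scaleC (complex_of_real r) T = r *\<^sub>R T"
  by (rule blinfun_eqI) (simp add: blinfun.scaleR_left scaleC_of_real)

lemma banach_subspace_UNIV: "banach_subspace UNIV (norm :: 'v::banach \<Rightarrow> real)"
proof
  fix \<sigma> :: "nat \<Rightarrow> 'v"
  assume "\<And>e. e > 0 \<Longrightarrow> \<exists>K. \<forall>m\<ge>K. \<forall>n\<ge>K. norm (\<sigma> m - \<sigma> n) < e"
  then have "Cauchy \<sigma>" by (simp add: Cauchy_def dist_norm)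
  then obtain x where "\<sigma> \<longlonglongrightarrow> x" using Cauchy_convergent convergent_def by blast
  then have "(\<lambda>n. norm (\<sigma> n - x)) \<longlonglongrightarrow> 0"
    by (simp add: LIM_zero_iff tendsto_norm_zero_iff)
  then show "\<exists>x\<in>UNIV. (\<lambda>n. norm (\<sigma> n - x)) \<longlonglongrightarrow> 0" by blast
qed (auto intro: norm_triangle_ineq)

lemma operator_ideal_banach_subspace:
  assumes "operator_ideal J N"
  shows "banach_subspace J N"
proof -
  have zero: "0 \<in> J"
    and add: "\<forall>S\<in>J. \<forall>T\<in>J. S + T \<in> J"
    and scale: "\<forall>c. \<forall>S\<in>J. blinfun_scaleC c S \<in> J"
    and triangle: "\<forall>S\<in>J. \<forall>T\<in>J. N (S + T) \<le> N S + N T"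
    and N_scale: "\<forall>c. \<forall>S\<in>J. N (blinfun_scaleC c S) = cmod c * N S"
    and complete: "\<forall>\<sigma> :: nat \<Rightarrow> 'a \<Rightarrow>\<^sub>L 'a.
        (\<forall>n. \<sigma> n \<in> J) \<and> (\<forall>e>0. \<exists>K. \<forall>m\<ge>K. \<forall>n\<ge>K. N (\<sigma> m - \<sigma> n) < e)
          \<longrightarrow> (\<exists>S\<in>J. (\<lambda>n. N (\<sigma> n - S)) \<longlonglongrightarrow> 0)"
    and norm_le: "\<forall>S\<in>J. norm S \<le> N S"
    using assms unfolding operator_ideal_def by - ((elim conjE, assumption)+)
  show ?thesis
  proof
    fix S r assume S: "S \<in> J"
    show "r *\<^sub>R S \<in> J" "N (r *\<^sub>R S) = \<bar>r\<bar> * N S"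
      using scale[rule_format, OF S, of "complex_of_real r"] N_scale[rule_format, OF S, of "complex_of_real r"]
      by (simp_all add: blinfun_scaleC_of_real)
  next
    fix \<sigma> :: "nat \<Rightarrow> 'a \<Rightarrow>\<^sub>L 'a"
    assume "\<And>n. \<sigma> n \<in> J" "\<And>e. e > 0 \<Longrightarrow> \<exists>K. \<forall>m\<ge>K. \<forall>n\<ge>K. N (\<sigma> m - \<sigma> n) < e"
    then show "\<exists>S\<in>J. (\<lambda>n. N (\<sigma> n - S)) \<longlonglongrightarrow> 0"
      by (intro complete[rule_format] conjI allI impI)
  qed (use zero add triangle norm_le in simp_all)
qed

text \<open>A left inverse agrees with a right inverse: the left inverse property of
  \<open>R\<close> is evaluated at \<open>R' y\<close>.\<close>

lemma resolvent_eqI: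
  assumes "is_resolvent_at z A R"
  shows "resolvent z A = R"
  unfolding resolvent_def
proof (rule the_equality)
  fix R' assume R': "is_resolvent_at z A R'"
  show "R' = R"
  proof (rule blinfun_eqI)
    fix y
    have "R' y \<in> Domain A" "z *\<^sub>C R' y - op_apply A (R' y) = y"
      using R' by (simp_all add: is_resolvent_at_def)
    moreover have "\<forall>x\<in>Domain A. R (z *\<^sub>C x - op_apply A x) = x"
      using assms by (simp add: is_resolvent_at_def)
    ultimately show "R' y = R y" by metis
  qed
qed (rule assms)

section \<open>Resolvent estimates and the functional calculus of one nonpositive operator\<close>

locale nonpos_op =
  fixes A :: "('a::complex_banach) unbounded_op"
  assumes nonpos: "A \<in> nonpos_ops"
begin

abbreviation R :: "real \<Rightarrow> 'a \<Rightarrow>\<^sub>L 'a" where "R t \<equiv> resolvent (complex_of_real t) A"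
abbreviation M :: real where "M \<equiv> nonpos_const A"

lemma resolvent_at:
  assumes "0 < t"
  shows "is_resolvent_at (complex_of_real t) A (R t)"
  using nonpos assms resolvent_eqI by (fastforce simp: nonpos_ops_def resolvent_set_def)

lemma resolvent_bounded: "0 < t \<Longrightarrow> R t \<in> bounded_ops"
  using resolvent_at by (simp add: is_resolvent_at_def)

lemma resolvent_mem_Domain: "0 < t \<Longrightarrow> R t y \<in> Domain A"
  using resolvent_at by (simp add: is_resolvent_at_def)

lemma resolvent_left: "0 < t \<Longrightarrow> x \<in> Domain A \<Longrightarrow> R t (t *\<^sub>R x - op_apply A x) = x"
  using resolvent_at[of t] by (simp add: is_resolvent_at_def scaleC_of_real)

lemma op_apply_resolvent: "0 < t \<Longrightarrow> op_apply A (R t y) = t *\<^sub>R R t y - y"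
proof -
  assume "0 < t"
  then have "t *\<^sub>R R t y - op_apply A (R t y) = y"
    using resolvent_at[of t] by (simp add: is_resolvent_at_def scaleC_of_real)
  then show ?thesis by (simp add: algebra_simps)
qed

lemma resolvent_op_apply: "0 < t \<Longrightarrow> x \<in> Domain A \<Longrightarrow> R t (op_apply A x) = t *\<^sub>R R t x - x"
  using resolvent_left[of t x] by (simp add: blinfun.bilinear_simps algebra_simps)

lemma resolvent_inj:
  assumes "0 < t" "R t x = R t y"
  shows "x = y"
proof -
  have "t *\<^sub>R R t x - op_apply A (R t x) = x" "t *\<^sub>R R t y - op_apply A (R t y) = y"
    by (simp_all add: op_apply_resolvent assms(1))
  then show ?thesis using assms(2) by metis
qed

lemma norm_resolvent: "0 < t \<Longrightarrow> norm (R t) \<le> M / t"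
proof -
  assume t: "0 < t"
  have "norm (t *\<^sub>R R t) \<le> M"
    unfolding nonpos_const_def using nonpos t
    by (intro cSUP_upper) (auto simp: nonpos_ops_def)
  then show ?thesis using t by (simp add: field_simps)
qed

lemma M_nonneg: "0 \<le> M"
  using norm_resolvent[of 1] norm_ge_zero[of "R 1"] by linarith

lemma resolvent_identity:
  assumes "0 < t" "0 < u"
  shows "R t - R u = (u - t) *\<^sub>R (R t o\<^sub>L R u)"
proof (rule blinfun_eqI)
  fix y
  have "R t (t *\<^sub>R R u y - op_apply A (R u y)) = R u y"
    by (rule resolvent_left[OF assms(1) resolvent_mem_Domain[OF assms(2)]])
  then show "(R t - R u) y = ((u - t) *\<^sub>R (R t o\<^sub>L R u)) y"
    by (simp add: op_apply_resolvent[OF assms(2)] blinfun.bilinear_simps algebra_simps)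
qed

text \<open>Exchanging \<open>t\<close> and \<open>u\<close> in the resolvent identity changes only
  the sign of its left side.\<close>

lemma resolvent_commute:
  assumes "0 < t" "0 < u"
  shows "R t o\<^sub>L R u = R u o\<^sub>L R t"
proof (cases "t = u")
  case False
  have "(u - t) *\<^sub>R (R t o\<^sub>L R u) = (u - t) *\<^sub>R (R u o\<^sub>L R t)"
    using resolvent_identity[OF assms] resolvent_identity[OF assms(2,1)]
    by (metis minus_diff_eq scaleR_minus_left)
  then show ?thesis using False by simp
qed simp

lemma resolvent_lipschitz:
  assumes "0 < t" "t \<le> u"
  shows "norm (R u - R t) \<le> M\<^sup>2 * (u - t) / t\<^sup>2"
proof -
  have "norm (R u - R t) \<le> (u - t) * (norm (R u) * norm (R t))"
    using resolvent_identity[of u t] norm_blinfun_compose[of "R u" "R t"] assms by (simp add: mult_left_mono)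
  also have "\<dots> \<le> (u - t) * ((M / t) * (M / t))"
    using norm_resolvent[of t] norm_resolvent[of u] assms M_nonneg divide_left_mono[of t u M]
    by (intro mult_left_mono mult_mono) auto
  finally show ?thesis by (simp add: power2_eq_square mult_ac)
qed

text \<open>The factor \<open>t\<close> improves the singularity at \<open>0\<close> from
  \<open>1 / t\<^sup>2\<close> to \<open>1 / t\<close>. After multiplication by a further resolvent
  of size \<open>M / t\<close>, the estimate has the form that \<open>strong_integral_exists\<close>
  requires.\<close>

lemma resolvent_scaled_lipschitz:
  assumes "0 < t" "t \<le> u"
  shows "norm (u *\<^sub>R R u - t *\<^sub>R R t) \<le> (M + M\<^sup>2) * (u - t) / t"
proof -
  have "u *\<^sub>R R u - t *\<^sub>R R t = (u - t) *\<^sub>R R u + t *\<^sub>R (R u - R t)"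
    by (simp add: algebra_simps)
  then have "norm (u *\<^sub>R R u - t *\<^sub>R R t) \<le> (u - t) * norm (R u) + t * norm (R u - R t)"
    using norm_triangle_ineq[of "(u - t) *\<^sub>R R u" "t *\<^sub>R (R u - R t)"] assms by simp
  also have "\<dots> \<le> (u - t) * (M / t) + t * (M\<^sup>2 * (u - t) / t\<^sup>2)"
    using norm_resolvent[of u] resolvent_lipschitz[OF assms] assms M_nonneg divide_left_mono[of t u M]
    by (intro add_mono mult_left_mono) auto
  also have "\<dots> = (M + M\<^sup>2) * (u - t) / t"
    using assms by (simp add: field_simps power2_eq_square)
  finally show ?thesis .
qed

lemma resolvent_integral_exists:
  assumes "sets \<mu> = sets (restrict_space borel {0<..})" "0 \<le> c" "(\<integral>\<^sup>+ t. ennreal (1 / t) \<partial>\<mu>) = ennreal c"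
  obtains W where "has_strong_integral \<mu> R W"
proof -
  interpret banach_subspace UNIV "norm :: ('a \<Rightarrow>\<^sub>L 'a) \<Rightarrow> real" by (rule banach_subspace_UNIV)
  have "\<exists>y\<in>UNIV. norm y \<le> M * c \<and> has_strong_integral \<mu> R y"
    using assms norm_resolvent resolvent_lipschitz by (intro strong_integral_exists) auto
  then show ?thesis using that by blast
qed

text \<open>An integral that exists in operator norm may be evaluated at
  \<open>op_apply A x\<close>, which gives the value before closing the graph. The rest shows that
  the closure adds no second value above \<open>x\<close>.\<close>

lemma op_fun_on_Domain:
  assumes space: "space (OM_measure \<phi>) = {0<..}"
    and W: "has_strong_integral (OM_measure \<phi>) R W" and x: "x \<in> Domain A"
  shows "x \<in> Domain (op_fun \<phi> A)" and "op_apply (op_fun \<phi> A) x = W (op_apply A x)"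
proof -
  define G where "G = {(x, y). x \<in> Domain A \<and> has_strong_integral (OM_measure \<phi>) (\<lambda>t. op_apply A (R t x)) y}"
  have integrand: "op_apply A (R t x) = R t (op_apply A x)" if "t \<in> space (OM_measure \<phi>)" "x \<in> Domain A" for t x
    using that by (simp add: space op_apply_resolvent resolvent_op_apply)
  have W_int: "has_strong_integral (OM_measure \<phi>) (\<lambda>t. op_apply A (R t x)) (W (op_apply A x))" if "x \<in> Domain A" for x
    using has_strong_integral_bounded_linear[OF blinfun.bounded_linear_left W, of "op_apply A x"]
    by (rule has_strong_integral_cong[THEN iffD1, rotated]) (simp add: integrand that)
  \<comment> \<open>Both sides are strong integrals of \<open>\<lambda>t. R 1 (R t z)\<close>,
    because resolvents commute.\<close>
  have comm: "R 1 (W z) = W (R 1 z)" for z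
  proof -
    have "has_strong_integral (OM_measure \<phi>) (\<lambda>t. R t (R 1 z)) (W (R 1 z))"
      by (rule has_strong_integral_bounded_linear[OF blinfun.bounded_linear_left W])
    moreover have "has_strong_integral (OM_measure \<phi>) (\<lambda>t. R 1 (R t z)) (R 1 (W z))"
      by (intro has_strong_integral_bounded_linear[OF blinfun.bounded_linear_right]
            has_strong_integral_bounded_linear[OF blinfun.bounded_linear_left W])
    moreover have "R 1 (R t z) = R t (R 1 z)" if "t \<in> space (OM_measure \<phi>)" for t
      using resolvent_commute[of 1 t] that by (simp add: space flip: blinfun_apply_blinfun_compose)
    then have "has_strong_integral (OM_measure \<phi>) (\<lambda>t. R 1 (R t z)) (W (R 1 z)) \<longleftrightarrow>
        has_strong_integral (OM_measure \<phi>) (\<lambda>t. R t (R 1 z)) (W (R 1 z))"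
      by (rule has_strong_integral_cong)
    ultimately show ?thesis
      by (intro has_strong_integral_unique[of "OM_measure \<phi>" "\<lambda>t. R 1 (R t z)"]) simp_all
  qed
  \<comment> \<open>\<open>R 1 (fst p) - fst p\<close> is \<open>A\<close> applied to
    \<open>R 1 (fst p)\<close>, expressed through bounded operators only; hence \<open>C\<close> is
    closed.\<close>
  define C where "C = {p. R 1 (snd p) = W (R 1 (fst p) - fst p)}"
  have "closed C"
    unfolding C_def by (intro closed_Collect_eq continuous_intros)
  moreover have "G \<subseteq> C"
  proof
    fix p assume "p \<in> G"
    then obtain x y where p: "p = (x, y)" "x \<in> Domain A" "has_strong_integral (OM_measure \<phi>) (\<lambda>t. op_apply A (R t x)) y"
      by (auto simp: G_def)
    then have "y = W (op_apply A x)"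
      using W_int has_strong_integral_unique by blast
    then have "R 1 y = W (R 1 (op_apply A x))"
      using comm by blast
    then show "p \<in> C"
      using p(1,2) resolvent_op_apply[of 1 x] by (simp add: C_def)
  qed
  ultimately have C: "op_fun \<phi> A \<subseteq> C"
    unfolding op_fun_def G_def by (intro closure_minimal)
  have mem: "(x, W (op_apply A x)) \<in> op_fun \<phi> A"
    unfolding op_fun_def using x W_int by (intro subsetD[OF closure_subset]) auto
  then show "x \<in> Domain (op_fun \<phi> A)" by blast
  \<comment> \<open>The definite description needs a unique value: any two values above
    \<open>x\<close> have the same image under the injective operator \<open>R 1\<close>.\<close>
  show "op_apply (op_fun \<phi> A) x = W (op_apply A x)"
    unfolding op_apply_def
  proof (rule the_equality)
    fix y assume "(x, y) \<in> op_fun \<phi> A"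
    then have "(x, y) \<in> C" "(x, W (op_apply A x)) \<in> C"
      using C mem by blast+
    then have "R 1 y = R 1 (W (op_apply A x))"
      by (simp add: C_def)
    then show "y = W (THE y. (x, y) \<in> A)"
      using resolvent_inj[of 1] by (simp add: op_apply_def)
  qed (use mem in \<open>simp add: op_apply_def\<close>)
qed

end

section \<open>The difference of the two functions as an integral in the ideal\<close>

theorem proposition3p6:
  fixes J :: "('a::complex_banach \<Rightarrow>\<^sub>L 'a) set"
    and N :: "('a \<Rightarrow>\<^sub>L 'a) \<Rightarrow> real"
    and \<phi> :: "complex \<Rightarrow> complex"
    and A B :: "'a unbounded_op"
    and S :: "'a \<Rightarrow>\<^sub>L 'a"
  assumes "operator_ideal J N"
    and "\<phi> \<in> OM_minus"
    and "deriv_minus_zero \<phi> \<noteq> \<infinity>"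
    and "A \<in> nonpos_ops" and "B \<in> nonpos_ops"
    and "Domain A \<subseteq> Domain B"
    and "difference_on (Domain A) A B S" and "S \<in> J"
  shows "\<exists>T. difference_on (Domain A) (op_fun \<phi> A) (op_fun \<phi> B) T \<and> T \<in> J \<and>
           N T \<le> nonpos_const A * nonpos_const B * real_of_ereal (deriv_minus_zero \<phi>) * N S"
proof -
  define \<mu> where "\<mu> = OM_measure \<phi>"
  have \<mu>: "represents_OM \<mu> \<phi>"
    using assms(2) unfolding \<mu>_def OM_measure_def OM_minus_def by (auto intro: someI)
  note space = represents_OM_space[OF \<mu>]
  have sets: "sets \<mu> = sets (restrict_space borel {0<..})"
    using \<mu> by (simp add: represents_OM_def)
  \<comment> \<open>By \<open>deriv_minus_zero_eq\<close> this extended real is the integral of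
    \<open>1 / t\<close>; nonnegative and not infinite, it is the real number
    \<open>c\<close>.\<close>
  define c where "c = real_of_ereal (deriv_minus_zero \<phi>)"
  have c: "0 \<le> c" "(\<integral>\<^sup>+ t. ennreal (1 / t) \<partial>\<mu>) = ennreal c"
    using assms(3) unfolding c_def deriv_minus_zero_eq[OF \<mu>]
    by (cases "\<integral>\<^sup>+ t. ennreal (1 / t) \<partial>\<mu>"; simp)+
  interpret A: nonpos_op A by standard (rule assms(4))
  interpret B: nonpos_op B by standard (rule assms(5))
  interpret J: banach_subspace J N by (rule operator_ideal_banach_subspace[OF assms(1)])
  have J_mem: "P o\<^sub>L S o\<^sub>L Q \<in> J" and J_bound: "N (P o\<^sub>L S o\<^sub>L Q) \<le> norm P * N S * norm Q"
    if "P \<in> bounded_ops" "Q \<in> bounded_ops" for P Q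
    using assms(1,8) that by (simp_all add: operator_ideal_def)
  have S_eq: "S x = op_apply A x - op_apply B x" if "x \<in> Domain A" for x
    using assms(7) that by (simp add: difference_on_def)
  note NS = J.N_nonneg[OF assms(8)]
  \<comment> \<open>By the second resolvent identity, \<open>f t x\<close> is the difference of the
    integrands defining the two functions at \<open>x\<close>. With \<open>S\<close> enclosed by
    bounded operators it lies in the ideal.\<close>
  define f where "f t = t *\<^sub>R (B.R t o\<^sub>L S o\<^sub>L A.R t)" for t
  have "\<exists>T\<in>J. N T \<le> (A.M * B.M * N S) * c \<and> has_strong_integral \<mu> f T"
  proof (rule J.strong_integral_exists[OF sets c])
    fix t :: real assume t: "0 < t"
    show f_mem: "f t \<in> J"
      unfolding f_def by (intro J.scaleR_mem J_mem B.resolvent_bounded A.resolvent_bounded t)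
    have "N (f t) = t * N (B.R t o\<^sub>L S o\<^sub>L A.R t)"
      unfolding f_def using J.N_scaleR[OF J_mem[OF B.resolvent_bounded[OF t] A.resolvent_bounded[OF t]]] t by simp
    \<comment> \<open>Each resolvent contributes \<open>1 / t\<close> and the prefactor
      \<open>t\<close> cancels one of them, leaving \<open>K = A.M * B.M * N S\<close>.\<close>
    also have "\<dots> \<le> t * ((B.M / t) * N S * (A.M / t))"
      using t A.M_nonneg B.M_nonneg NS A.norm_resolvent[OF t] B.norm_resolvent[OF t]
      by (intro mult_left_mono order_trans[OF J_bound[OF B.resolvent_bounded[OF t] A.resolvent_bounded[OF t]]] mult_mono) auto
    also have "\<dots> = A.M * B.M * N S / t"
      using t by (simp add: mult_ac)
    finally show "N (f t) \<le> A.M * B.M * N S / t" .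
    fix u assume u: "t \<le> u"
    then have u0: "0 < u" using t by simp
    \<comment> \<open>The product is varied one factor at a time, with the prefactor
      \<open>t\<close> attached to \<open>B.R t\<close>. Both terms keep \<open>S\<close> in the
      middle, and both are of order \<open>(u - t) / t\<^sup>2\<close>.\<close>
    let ?P = "u *\<^sub>R B.R u - t *\<^sub>R B.R t" and ?Q = "A.R u - A.R t"
    have bd: "?P \<in> bounded_ops" "?Q \<in> bounded_ops" "t *\<^sub>R B.R t \<in> bounded_ops"
      by (intro bounded_ops_diff bounded_ops_scaleR A.resolvent_bounded B.resolvent_bounded t u0)+
    have "f u - f t = (?P o\<^sub>L S o\<^sub>L A.R u) + (t *\<^sub>R B.R t o\<^sub>L S o\<^sub>L ?Q)"
      by (rule blinfun_eqI) (simp add: f_def blinfun.bilinear_simps algebra_simps)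
    then have "N (f u - f t) \<le> N (?P o\<^sub>L S o\<^sub>L A.R u) + N (t *\<^sub>R B.R t o\<^sub>L S o\<^sub>L ?Q)"
      using J.N_triangle[OF J_mem[OF bd(1) A.resolvent_bounded[OF u0]] J_mem[OF bd(3,2)]] by simp
    also have "\<dots> \<le> norm ?P * N S * norm (A.R u) + norm (t *\<^sub>R B.R t) * N S * norm ?Q"
      by (intro add_mono J_bound bd A.resolvent_bounded u0)
    also have "\<dots> \<le> ((B.M + B.M\<^sup>2) * (u - t) / t) * N S * (A.M / t) + B.M * N S * (A.M\<^sup>2 * (u - t) / t\<^sup>2)"
    proof (intro add_mono mult_mono order_refl)
      show "norm ?P \<le> (B.M + B.M\<^sup>2) * (u - t) / t" by (rule B.resolvent_scaled_lipschitz[OF t u])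
      show "norm ?Q \<le> A.M\<^sup>2 * (u - t) / t\<^sup>2" by (rule A.resolvent_lipschitz[OF t u])
      show "norm (A.R u) \<le> A.M / t"
        using A.norm_resolvent[OF u0] divide_left_mono[OF u A.M_nonneg] t u0 by (meson order_trans mult_pos_pos)
      show "norm (t *\<^sub>R B.R t) \<le> B.M"
        using B.norm_resolvent[OF t] t by (simp add: field_simps)
    qed (use t u NS A.M_nonneg B.M_nonneg in auto)
    also have "\<dots> = ((B.M + B.M\<^sup>2) * N S * A.M + B.M * N S * A.M\<^sup>2) * (u - t) / t\<^sup>2"
      by (simp add: power2_eq_square[of t] add_divide_distrib diff_divide_distrib algebra_simps)
    finally show "N (f u - f t) \<le> ((B.M + B.M\<^sup>2) * N S * A.M + B.M * N S * A.M\<^sup>2) * (u - t) / t\<^sup>2" .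
  qed
  then obtain T where T: "T \<in> J" "N T \<le> (A.M * B.M * N S) * c" "has_strong_integral \<mu> f T"
    by blast
  obtain WA where WA: "has_strong_integral \<mu> A.R WA"
    using A.resolvent_integral_exists[OF sets c] .
  obtain WB where WB: "has_strong_integral \<mu> B.R WB"
    using B.resolvent_integral_exists[OF sets c] .
  note op_A = A.op_fun_on_Domain[OF space[unfolded \<mu>_def] WA[unfolded \<mu>_def]]
  note op_B = B.op_fun_on_Domain[OF space[unfolded \<mu>_def] WB[unfolded \<mu>_def]]
  \<comment> \<open>Evaluation of \<open>f\<close> at \<open>x\<close> and the difference of the two
    resolvent integrals have the same integrand, so uniqueness of strong integrals identifies the
    values.\<close>
  have T_eq: "T x = WA (op_apply A x) - WB (op_apply B x)" if x: "x \<in> Domain A" for x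
  proof -
    have "f t x = A.R t (op_apply A x) - B.R t (op_apply B x)" if "t \<in> space \<mu>" for t
    proof -
      have t: "0 < t" using that by (simp add: space)
      let ?z = "A.R t x"
      have z: "?z \<in> Domain A" "?z \<in> Domain B"
        using A.resolvent_mem_Domain[OF t] assms(6) by auto
      \<comment> \<open>Since \<open>A\<close> maps \<open>?z\<close> to
        \<open>t *\<^sub>R ?z - x\<close>, the vector \<open>S ?z\<close> is \<open>t - B\<close>
        applied to \<open>?z\<close>, which \<open>B.R t\<close> inverts as \<open>?z\<close> lies
        in the domain of \<open>B\<close>, minus \<open>x\<close>.\<close>
      have "S ?z = (t *\<^sub>R ?z - op_apply B ?z) - x"
        using S_eq[OF z(1)] A.op_apply_resolvent[OF t, of x] by simp
      then have "B.R t (S ?z) = ?z - B.R t x"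
        using B.resolvent_left[OF t z(2)] by (simp add: blinfun.diff_right)
      then have "f t x = (t *\<^sub>R ?z - x) - (t *\<^sub>R B.R t x - x)"
        by (simp add: f_def blinfun.scaleR_left scaleR_diff_right)
      then show ?thesis
        using A.resolvent_op_apply[OF t x] B.resolvent_op_apply[OF t subsetD[OF assms(6) x]] by simp
    qed
    then have "has_strong_integral \<mu> (\<lambda>t. A.R t (op_apply A x) - B.R t (op_apply B x)) (T x)"
      by (rule has_strong_integral_cong[THEN iffD1, OF _ has_strong_integral_bounded_linear[OF blinfun.bounded_linear_left T(3)]])
    moreover have "has_strong_integral \<mu> (\<lambda>t. A.R t (op_apply A x) - B.R t (op_apply B x))
        (WA (op_apply A x) - WB (op_apply B x))"
      by (intro has_strong_integral_diff has_strong_integral_bounded_linear[OF blinfun.bounded_linear_left] WA WB)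
    ultimately show ?thesis
      by (rule has_strong_integral_unique)
  qed
  have "difference_on (Domain A) (op_fun \<phi> A) (op_fun \<phi> B) T"
    unfolding difference_on_def
  proof (intro conjI ballI subsetI)
    show "T \<in> bounded_ops"
      using T(1) assms(1) by (auto simp: operator_ideal_def)
  qed (use op_A op_B[OF subsetD[OF assms(6)]] T_eq in auto)
  moreover have "N T \<le> A.M * B.M * c * N S"
    using T(2) by (simp add: mult_ac)
  ultimately show ?thesis
    using T(1) unfolding c_def by blast
qed

end
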